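(* Let $\mathcal{H}$ be a real Hilbert space, let $D\subset\mathcal{H}$ be a nonempty closed convex set, and let $(T_t)_{t>0}$ be a family of nonexpansive operators from $D$ into $D$. Let $\varepsilon\colon[0,\infty)\to(0,\infty)$ be absolutely continuous and nonincreasing with $\lim_{t\to+\infty}\varepsilon(t)=0$ and $\int_0^{+\infty}\varepsilon(s)\,ds=+\infty$, and let $y\colon[0,\infty)\to D$ be locally absolutely continuous, with $y(t)$ converging to a point of $D$ and $\|\dot y(t)\|\to0$ as $t\to+\infty$. Assume that the maps $t\mapsto\varepsilon(t)$, $t\mapsto y(t)$ and, for every $x\in D$, $t\mapsto T_t(x)$ are locally integrable on $[0,\infty)$. Let $x_0\in D$. Then the dynamical system $$-\dot x(t)=x(t)-T_t(x(t))+\varepsilon(t)\big(x(t)-y(t)\big)\ \text{ for a.e. } t\ge0,\qquad x(0)=x_0,$$ admits a unique solution $x\in \operatorname{AC}_{\mathrm{loc}}(\mathbb{R}_+;\mathcal{H})$. Moreover, this solution satisfies $x(t)\in D$ for all $t\ge 0$.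
   Context: An operator $T\colon D\to D$ is nonexpansive if $\|T(x)-T(x')\|\le\|x-x'\|$ for all $x,x'\in D$. $\operatorname{AC}_{\mathrm{loc}}(\mathbb{R}_+;\mathcal{H})$ is the set of locally absolutely continuous functions from $[0,\infty)$ to $\mathcal{H}$; local integrability is in the Bochner sense. Since each $T_t$ is defined only on $D$, a solution is understood to be $D$-valued (so that $T_t(x(t))$ makes sense). Limits of $\dot y$, which is defined only for a.e. $t$, are essential limits. *)

theory Defs
  imports "HOL-Analysis.Analysis"
begin

definition nonexpansive_on :: "'a::real_normed_vector set \<Rightarrow> ('a \<Rightarrow> 'a) \<Rightarrow> bool" where
  "nonexpansive_on D T \<longleftrightarrow> T ` D \<subseteq> D \<and> (\<forall>x\<in>D. \<forall>x'\<in>D. norm (T x - T x') \<le> norm (x - x'))"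

definition absolutely_continuous_on :: "real set \<Rightarrow> (real \<Rightarrow> 'a::real_normed_vector) \<Rightarrow> bool" where
  "absolutely_continuous_on S f \<longleftrightarrow>
    (\<forall>e>0. \<exists>d>0. \<forall>(n::nat) (a::nat \<Rightarrow> real) (b::nat \<Rightarrow> real).
      (\<forall>k<n. a k \<le> b k \<and> {a k..b k} \<subseteq> S) \<longrightarrow>
      disjoint_family_on (\<lambda>k. {a k<..<b k}) {..<n} \<longrightarrow>
      (\<Sum>k<n. b k - a k) < d \<longrightarrow>
      (\<Sum>k<n. norm (f (b k) - f (a k))) < e)"

text \<open>A function on the half-line is represented by a function on all reals; only its values
  on \<open>{0..}\<close> matter.\<close>

definition AC_loc :: "(real \<Rightarrow> 'a::real_normed_vector) \<Rightarrow> bool" where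
  "AC_loc f \<longleftrightarrow> (\<forall>b\<ge>0. absolutely_continuous_on {0..b} f)"

text \<open>The library predicate \<open>integrable\<close> is restricted to second countable target spaces. The
  following definitions of strong measurability and Bochner integrability have no such
  restriction, so that nonseparable Hilbert spaces are covered.\<close>

definition strongly_measurable :: "'b measure \<Rightarrow> ('b \<Rightarrow> 'a::real_normed_vector) \<Rightarrow> bool" where
  "strongly_measurable M f \<longleftrightarrow>
    (\<exists>s. (\<forall>i::nat. simple_function M (s i)) \<and> (AE x in M. (\<lambda>i. s i x) \<longlonglongrightarrow> f x))"

definition bochner_integrable :: "'b measure \<Rightarrow> ('b \<Rightarrow> 'a::real_normed_vector) \<Rightarrow> bool" where
  "bochner_integrable M f \<longleftrightarrow> strongly_measurable M f \<and>
    (\<exists>s. (\<forall>i::nat. Bochner_Integration.simple_bochner_integrable M (s i)) \<and>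
         (\<lambda>i. \<integral>\<^sup>+x. ennreal (norm (f x - s i x)) \<partial>M) \<longlonglongrightarrow> 0)"

definition locally_integrable :: "(real \<Rightarrow> 'a::real_normed_vector) \<Rightarrow> bool" where
  "locally_integrable f \<longleftrightarrow>
    (\<forall>b\<ge>0. bochner_integrable lebesgue (\<lambda>t. indicator {0..b} t *\<^sub>R f t))"

text \<open>Neighbourhoods of infinity modulo Lebesgue null sets: convergence along this filter is
  the essential limit as \<open>t\<close> tends to infinity.\<close>

definition ess_at_top :: "real filter" where
  "ess_at_top = inf at_top (ae_filter lebesgue)"

text \<open>The value \<open>T 0\<close> is irrelevant, since the equation is only required almost everywhere.\<close>

definition is_solution ::
  "'a::real_normed_vector set \<Rightarrow> (real \<Rightarrow> 'a \<Rightarrow> 'a) \<Rightarrow> (real \<Rightarrow> real) \<Rightarrow> (real \<Rightarrow> 'a) \<Rightarrow> 'a \<Rightarrow>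
   (real \<Rightarrow> 'a) \<Rightarrow> bool" where
  "is_solution D T \<epsilon> y x0 x \<longleftrightarrow>
    AC_loc x \<and> (\<forall>t\<ge>0. x t \<in> D) \<and>
    (AE t in lebesgue. t \<ge> 0 \<longrightarrow>
      (\<exists>x'. (x has_vector_derivative x') (at t within {0..}) \<and>
            - x' = x t - T t (x t) + \<epsilon> t *\<^sub>R (x t - y t))) \<and>
    x 0 = x0"

end

theory Submission
  imports Defs
begin

text \<open>
  Let \<open>A(t)\<close> be the integral of \<open>1 + \<epsilon>\<close> over \<open>[0, t]\<close>. Variation of constants turns the differential
  equation into the fixed point problem \<open>x = \<Phi>(x)\<close> with
  \<open>\<Phi>(x)(t) = e\<^bsup>-A(t)\<^esup> (x\<^sub>0 + \<integral> e\<^bsup>A(s)\<^esup> (T\<^sub>s(x(s)) + \<epsilon>(s) y(s)) ds)\<close>, the integral being over \<open>[0, t]\<close>. Two remarks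
  about \<open>\<Phi>\<close> carry the proof of existence.

  Since \<open>e\<^sup>A (1 + \<epsilon>)\<close> integrates to \<open>e\<^bsup>A(t)\<^esup> - 1\<close>, the value \<open>\<Phi>(x)(t)\<close> is a convex combination of \<open>x\<^sub>0\<close> and
  of a weighted mean of the points \<open>(T\<^sub>s(x(s)) + \<epsilon>(s) y(s)) / (1 + \<epsilon>(s))\<close>, which belong to \<open>D\<close>. As \<open>D\<close>
  is closed and convex, such a mean is in \<open>D\<close> (\<open>weighted_mean_in_convex\<close>), so \<open>\<Phi>\<close> maps continuous
  \<open>D\<close>-valued functions to continuous \<open>D\<close>-valued functions (\<open>picard_in_D\<close>). Moreover, because the \<open>T\<^sub>s\<close>
  are nonexpansive, \<open>\<Phi>\<close> is a contraction with constant \<open>1 - e\<^bsup>-A(b)\<^esup>\<close> for the supremum norm on \<open>[0, b]\<close>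
  (\<open>picard_contraction\<close>), so the iterates of \<open>\<Phi>\<close> converge, uniformly on every \<open>[0, b]\<close>, to a
  fixed point (\<open>picard_fixed_point\<close>).

  The passage from the fixed point back to the differential equation needs integrals of functions
  with values in a possibly nonseparable space: they must exist, be absolutely continuous in the
  upper limit, and have the integrand as derivative almost everywhere. The integral is taken in the
  Henstock-Kurzweil sense, for functions that can be approximated by finite sums \<open>\<Sum> \<alpha>\<^sub>k(t) v\<^sub>k\<close> up to
  an error dominated by a real function of small integral (\<open>bochner_on\<close>). For the finite sums all
  claims reduce to real functions, in particular to Lebesgue's differentiation theorem, and the
  dominating functions control the limit (\<open>absolutely_continuous_on_primitive\<close>,
  \<open>has_vector_derivative_primitive_ae\<close>).

  For uniqueness, the squared distance of two solutions is absolutely continuous, and its derivative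
  is almost everywhere nonpositive by nonexpansiveness and the Cauchy-Schwarz inequality; hence it is
  nonincreasing (\<open>absolutely_continuous_nonincreasing\<close>), and it vanishes at time \<open>0\<close>.
\<close>

section \<open>Lebesgue's differentiation theorem on the line\<close>

text \<open>
  Every point of the set is a tag of arbitrarily short intervals on which the integral differs from
  the tag's value by at least \<open>\<eta>\<close> times the length. By Henstock's lemma, the total length of disjoint
  such intervals that are fine for a suitable gauge is small; by Vitali's covering lemma, disjoint
  ones can be selected whose fivefold enlargements still cover the set.
\<close>
lemma negligible_large_average_deviation:
  fixes f :: "real \<Rightarrow> real"
  assumes f: "f integrable_on {a..b}" and "\<eta> > 0"
  shows "negligible {t. \<forall>d>0. \<exists>u v. a \<le> u \<and> u \<le> t \<and> t \<le> v \<and> v \<le> b \<and> u < v \<and> v - u < d \<and>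
            \<eta> * (v - u) \<le> \<bar>(v - u) * f t - integral {u..v} f\<bar>}" (is "negligible ?E")
  unfolding negligible_outer_le
proof (intro allI impI)
  fix e :: real assume "e > 0"
  \<comment> \<open>Vitali enlarges by the factor 5, and lengths are bounded by deviations divided by \<open>\<eta>\<close>.\<close>
  define e' where "e' = \<eta> * e / 5"
  have "e' > 0" using \<open>e > 0\<close> \<open>\<eta> > 0\<close> by (simp add: e'_def)
  have "f integrable_on cbox a b" using f by simp
  then obtain \<gamma> where "gauge \<gamma>"
    and \<gamma>: "\<And>p. \<lbrakk>p tagged_partial_division_of (cbox a b); \<gamma> fine p\<rbrakk> \<Longrightarrow>
             sum (\<lambda>(x,k). norm (measure lborel k *\<^sub>R f x - integral k f)) p < e'"
    using Henstock_lemma[OF _ \<open>e' > 0\<close>] by blast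
  \<comment> \<open>A triple \<open>(t, u, v)\<close> stands for the interval \<open>[u, v]\<close> with tag \<open>t\<close>, a ball with centre \<open>m\<close> and radius \<open>r\<close>.\<close>
  define K where "K = {(t, u, v). a \<le> u \<and> u \<le> t \<and> t \<le> v \<and> v \<le> b \<and> u < v \<and> {u..v} \<subseteq> \<gamma> t \<and>
            \<eta> * (v - u) \<le> \<bar>(v - u) * f t - integral {u..v} f\<bar>}"
  define m :: "real \<times> real \<times> real \<Rightarrow> real" where "m = (\<lambda>(t,u,v). (u + v) / 2)"
  define r :: "real \<times> real \<times> real \<Rightarrow> real" where "r = (\<lambda>(t,u,v). (v - u) / 2)"
  have cball_eq: "cball (m (t,u,v)) (r (t,u,v)) = {u..v}" for t u v
    unfolding m_def r_def by (auto simp: cball_eq_atLeastAtMost field_simps)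
  have cov: "?E \<subseteq> (\<Union>i\<in>K. cball (m i) (r i))"
  proof
    fix t assume t: "t \<in> ?E"
    obtain d where "d > 0" and d: "ball t d \<subseteq> \<gamma> t"
      using gaugeD[OF \<open>gauge \<gamma>\<close>, of t] openE by metis
    obtain u v where uv: "a \<le> u" "u \<le> t" "t \<le> v" "v \<le> b" "u < v" "v - u < d"
         "\<eta> * (v - u) \<le> \<bar>(v - u) * f t - integral {u..v} f\<bar>"
      using t \<open>d > 0\<close> by blast
    have "{u..v} \<subseteq> ball t d" using uv by (auto simp: dist_real_def)
    then have "(t,u,v) \<in> K" using uv d by (auto simp: K_def)
    moreover have "t \<in> cball (m (t,u,v)) (r (t,u,v))" using uv cball_eq by simp
    ultimately show "t \<in> (\<Union>i\<in>K. cball (m i) (r i))" by blast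
  qed
  have rad: "0 < r i \<and> r i \<le> b - a" if "i \<in> K" for i
    using that by (auto simp: K_def r_def)
  obtain C where "countable C" "C \<subseteq> K"
     and disj: "pairwise (\<lambda>i j. disjnt (cball (m i) (r i)) (cball (m j) (r j))) C"
     and cover: "?E \<subseteq> (\<Union>i\<in>C. cball (m i) (5 * r i))"
    by (rule Vitali_covering_lemma_cballs[OF cov rad])
  have sum_r: "(\<Sum>i\<in>C'. measure lebesgue (cball (m i) (5 * r i))) \<le> e" if "C' \<subseteq> C" "finite C'" for C'
  proof -
    define J where "J = (\<lambda>(t::real,u::real,v::real). (t, {u..v}))"
    have CK: "C' \<subseteq> K" using that \<open>C \<subseteq> K\<close> by blast
    have same: "(t,u,v) = (t',u',v')"
      if "(t,u,v) \<in> C'" "(t',u',v') \<in> C'" "x \<in> {u..v}" "x \<in> {u'..v'}" for t u v t' u' v' x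
    proof (rule ccontr)
      assume "(t,u,v) \<noteq> (t',u',v')"
      then have "disjnt (cball (m (t,u,v)) (r (t,u,v))) (cball (m (t',u',v')) (r (t',u',v')))"
        by (rule pairwiseD[OF disj, rotated 2]) (use that \<open>C' \<subseteq> C\<close> in auto)
      then show False using that unfolding cball_eq disjnt_def by blast
    qed
    have "J ` C' tagged_partial_division_of cbox a b"
      unfolding tagged_partial_division_of_def
    proof (intro conjI allI impI)
      show "finite (J ` C')" using that by simp
    next
      fix x k assume "(x,k) \<in> J ` C'"
      then obtain u v where uv: "(x,u,v) \<in> C'" "k = {u..v}" by (auto simp: J_def)
      show "x \<in> k" "k \<subseteq> cbox a b" using uv CK by (auto simp: K_def)
      show "\<exists>a b. k = cbox a b" using uv by (metis box_real(2))
    next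
      fix x1 k1 x2 k2
      assume h: "(x1,k1) \<in> J ` C' \<and> (x2,k2) \<in> J ` C' \<and> (x1,k1) \<noteq> (x2,k2)"
      then obtain u1 v1 u2 v2 where uv: "(x1,u1,v1) \<in> C'" "k1 = {u1..v1}"
          "(x2,u2,v2) \<in> C'" "k2 = {u2..v2}" by (auto simp: J_def)
      have "k1 \<inter> k2 = {}" using same[OF uv(1,3)] h uv(2,4) by blast
      then show "interior k1 \<inter> interior k2 = {}" using interior_subset by blast
    qed
    moreover have "\<gamma> fine J ` C'"
      using CK by (fastforce simp: fine_def J_def K_def)
    ultimately have "sum (\<lambda>(x,k). norm (measure lborel k *\<^sub>R f x - integral k f)) (J ` C') < e'"
      by (rule \<gamma>)
    moreover have "inj_on J C'"
    proof (rule inj_onI)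
      fix i j
      assume ij: "i \<in> C'" "j \<in> C'" "J i = J j"
      obtain t u v where i: "i = (t,u,v)" by (rule prod_cases3)
      obtain t' u' v' where j: "j = (t',u',v')" by (rule prod_cases3)
      have "u \<in> {u..v}" "{u..v} = {u'..v'}" using ij CK by (auto simp: K_def J_def i j)
      then show "i = j" using same[of t u v t' u' v' u] ij by (simp add: i j)
    qed
    ultimately have "(\<Sum>i\<in>C'. case J i of (x,k) \<Rightarrow> norm (measure lborel k *\<^sub>R f x - integral k f)) < e'"
      by (simp add: sum.reindex o_def)
    moreover have "\<eta> * (2 * r i) \<le> (case J i of (x,k) \<Rightarrow> norm (measure lborel k *\<^sub>R f x - integral k f))"
      if "i \<in> C'" for i
    proof -
      obtain t u v where i: "i = (t,u,v)" by (rule prod_cases3)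
      then have "\<eta> * (v - u) \<le> \<bar>(v - u) * f t - integral {u..v} f\<bar>" "u < v"
        using that CK by (auto simp: K_def)
      moreover have "2 * r i = v - u" by (simp add: r_def i)
      ultimately show ?thesis by (simp add: J_def i)
    qed
    then have "(\<Sum>i\<in>C'. \<eta> * (2 * r i)) \<le>
        (\<Sum>i\<in>C'. case J i of (x,k) \<Rightarrow> norm (measure lborel k *\<^sub>R f x - integral k f))"
      by (rule sum_mono)
    ultimately have "\<eta> * (\<Sum>i\<in>C'. 2 * r i) < e'" by (simp add: sum_distrib_left)
    then have "(\<Sum>i\<in>C'. 2 * r i) < e / 5"
      using \<open>\<eta> > 0\<close> by (simp add: e'_def field_simps)
    moreover have "measure lebesgue (cball (m i) (5 * r i)) = 5 * (2 * r i)" if "i \<in> C'" for i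
    proof -
      have "0 < r i" using that CK by (auto simp: K_def r_def)
      then show ?thesis by (simp add: cball_eq_atLeastAtMost)
    qed
    then have "(\<Sum>i\<in>C'. measure lebesgue (cball (m i) (5 * r i))) = 5 * (\<Sum>i\<in>C'. 2 * r i)"
      by (simp add: sum_distrib_left)
    ultimately show ?thesis by simp
  qed
  have measure_le: "measure lebesgue (\<Union>i\<in>C'. cball (m i) (5 * r i)) \<le> e"
    if "C' \<subseteq> C" "finite C'" for C'
  proof -
    have "measure lebesgue (\<Union>i\<in>C'. cball (m i) (5 * r i))
        \<le> (\<Sum>i\<in>C'. measure lebesgue (cball (m i) (5 * r i)))"
      by (rule measure_UNION_le[OF \<open>finite C'\<close>]) auto
    then show ?thesis using sum_r[OF that] by linarith
  qed
  have "(\<Union>i\<in>C. cball (m i) (5 * r i)) \<in> lmeasurable"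
    by (rule fmeasurable_UN_bound[OF \<open>countable C\<close> _ measure_le]) auto
  moreover have "measure lebesgue (\<Union>i\<in>C. cball (m i) (5 * r i)) \<le> e"
    by (rule measure_UN_bound[OF \<open>countable C\<close> _ measure_le]) auto
  ultimately show "\<exists>T. ?E \<subseteq> T \<and> T \<in> lmeasurable \<and> measure lebesgue T \<le> e"
    using cover by blast
qed

theorem lebesgue_differentiation_real:
  fixes f :: "real \<Rightarrow> real"
  assumes f: "f integrable_on {a..b}"
  shows "negligible {t \<in> {a<..<b}. \<not> ((\<lambda>x. integral {a..x} f) has_vector_derivative f t) (at t)}"
proof -
  define E where "E = (\<lambda>n. {t. \<forall>d>0. \<exists>u v. a \<le> u \<and> u \<le> t \<and> t \<le> v \<and> v \<le> b \<and> u < v \<and> v - u < d \<and>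
            inverse (real (Suc n)) * (v - u) \<le> \<bar>(v - u) * f t - integral {u..v} f\<bar>})"
  have "((\<lambda>x. integral {a..x} f) has_vector_derivative f t) (at t)"
    if t: "t \<in> {a<..<b}" "t \<notin> (\<Union>n. E n)" for t
    unfolding has_vector_derivative_def has_derivative_at_alt
  proof (intro conjI allI impI bounded_linear_scaleR_left)
    fix e :: real assume "e > 0"
    then obtain n where n: "inverse (real (Suc n)) < e" using reals_Archimedean by blast
    obtain d where "d > 0" and d: "\<And>u v. \<lbrakk>a \<le> u; u \<le> t; t \<le> v; v \<le> b; u < v; v - u < d\<rbrakk> \<Longrightarrow>
        \<bar>(v - u) * f t - integral {u..v} f\<bar> < inverse (real (Suc n)) * (v - u)"
    proof -
      have "t \<notin> E n" using t(2) by blast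
      then obtain d where "d > 0" and d: "\<nexists>u v. a \<le> u \<and> u \<le> t \<and> t \<le> v \<and> v \<le> b \<and> u < v \<and> v - u < d \<and>
            inverse (real (Suc n)) * (v - u) \<le> \<bar>(v - u) * f t - integral {u..v} f\<bar>"
        unfolding E_def mem_Collect_eq by blast
      have "\<bar>(v - u) * f t - integral {u..v} f\<bar> < inverse (real (Suc n)) * (v - u)"
        if "a \<le> u" "u \<le> t" "t \<le> v" "v \<le> b" "u < v" "v - u < d" for u v
        using d that not_le by blast
      then show ?thesis using that \<open>d > 0\<close> by blast
    qed
    have d': "\<bar>integral {u..v} f - (v - u) * f t\<bar> \<le> e * (v - u)"
      if "a \<le> u" "u \<le> t" "t \<le> v" "v \<le> b" "u \<le> v" "v - u < d" for u v
    proof (cases "u = v")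
      case False
      then have "\<bar>(v - u) * f t - integral {u..v} f\<bar> < inverse (real (Suc n)) * (v - u)"
        using d that by simp
      also have "\<dots> \<le> e * (v - u)" using n that by (intro mult_right_mono) auto
      finally show ?thesis by linarith
    qed simp
    have diff: "integral {a..v} f - integral {a..u} f = integral {u..v} f"
      if "a \<le> u" "u \<le> v" "v \<le> b" for u v
      using Henstock_Kurzweil_Integration.integral_combine[of a u v f]
        integrable_subinterval_real[OF f, of a v] that by auto
    show "\<exists>d>0. \<forall>y. norm (y - t) < d \<longrightarrow>
        norm (integral {a..y} f - integral {a..t} f - (y - t) *\<^sub>R f t) \<le> e * norm (y - t)"
    proof (intro exI[of _ "min d (min (t - a) (b - t))"] conjI allI impI)
      show "0 < min d (min (t - a) (b - t))" using t \<open>d > 0\<close> by auto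
      fix y assume y: "norm (y - t) < min d (min (t - a) (b - t))"
      show "norm (integral {a..y} f - integral {a..t} f - (y - t) *\<^sub>R f t) \<le> e * norm (y - t)"
      proof (cases "t \<le> y")
        case True
        then show ?thesis using d'[of t y] diff[of t y] y t by auto
      next
        case False
        have "norm (integral {a..y} f - integral {a..t} f - (y - t) *\<^sub>R f t)
           = \<bar>integral {y..t} f - (t - y) * f t\<bar>"
          using diff[of y t] y t False by (simp add: algebra_simps)
        also have "\<dots> \<le> e * norm (y - t)" using d'[of y t] y t False by auto
        finally show ?thesis .
      qed
    qed
  qed
  then have "{t \<in> {a<..<b}. \<not> ((\<lambda>x. integral {a..x} f) has_vector_derivative f t) (at t)} \<subseteq> (\<Union>n. E n)"
    by blast
  moreover have "negligible (E n)" for n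
    unfolding E_def by (rule negligible_large_average_deviation[OF f]) simp
  then have "negligible (\<Union>n. E n)" by (intro negligible_countable_Union) auto
  ultimately show ?thesis using negligible_subset by blast
qed

section \<open>Absolutely continuous functions with nonpositive derivative\<close>

text \<open>
  The inner condition in the \<open>\<epsilon>\<close>-\<open>\<delta>\<close> definition of absolute continuity, with both constants exposed.
\<close>
definition small_increments :: "real set \<Rightarrow> (real \<Rightarrow> 'a::real_normed_vector) \<Rightarrow> real \<Rightarrow> real \<Rightarrow> bool" where
  "small_increments S f d e \<longleftrightarrow>
    (\<forall>(n::nat) a b. (\<forall>k<n. a k \<le> b k \<and> {a k..b k} \<subseteq> S) \<longrightarrow>
      disjoint_family_on (\<lambda>k. {a k<..<b k}) {..<n} \<longrightarrow>
      (\<Sum>k<n. b k - a k) < d \<longrightarrow>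
      (\<Sum>k<n. norm (f (b k) - f (a k))) < e)"

lemma absolutely_continuous_on_iff_small_increments:
  "absolutely_continuous_on S f \<longleftrightarrow> (\<forall>e>0. \<exists>d>0. small_increments S f d e)"
  unfolding absolutely_continuous_on_def small_increments_def ..

lemma small_incrementsI:
  assumes "\<And>(n::nat) a b. \<lbrakk>\<And>k. k < n \<Longrightarrow> a k \<le> b k \<and> {a k..b k} \<subseteq> S;
      disjoint_family_on (\<lambda>k. {a k<..<b k}) {..<n}; (\<Sum>k<n. b k - a k) < d\<rbrakk>
    \<Longrightarrow> (\<Sum>k<n. norm (f (b k) - f (a k))) < e"
  shows "small_increments S f d e"
  unfolding small_increments_def by (intro allI impI assms) auto

lemma small_incrementsD:
  fixes n :: nat
  assumes "small_increments S f d e" and "\<And>k. k < n \<Longrightarrow> a k \<le> b k \<and> {a k..b k} \<subseteq> S"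
    and "disjoint_family_on (\<lambda>k. {a k<..<b k}) {..<n}" and "(\<Sum>k<n. b k - a k) < d"
  shows "(\<Sum>k<n. norm (f (b k) - f (a k))) < e"
  using assms unfolding small_increments_def by blast

lemma absolutely_continuous_on_subset:
  assumes "absolutely_continuous_on S f" and "S' \<subseteq> S"
  shows "absolutely_continuous_on S' f"
proof -
  have "small_increments S' f d e" if "small_increments S f d e" for d e
    using small_incrementsD[OF that] assms(2) by (intro small_incrementsI) blast
  then show ?thesis
    using assms(1) unfolding absolutely_continuous_on_iff_small_increments by blast
qed

lemma absolutely_continuous_on_continuous:
  assumes "absolutely_continuous_on {a..b} f"
  shows "continuous_on {a..b} f"
  unfolding continuous_on_iff
proof (intro ballI allI impI)
  fix x e :: real assume x: "x \<in> {a..b}" and "0 < e"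
  then obtain d where "d > 0" and d: "small_increments {a..b} f d e"
    using assms unfolding absolutely_continuous_on_iff_small_increments by blast
  have d1: "norm (f v - f u) < e" if "u \<le> v" "u \<in> {a..b}" "v \<in> {a..b}" "v - u < d" for u v
    using small_incrementsD[OF d, of "Suc 0" "\<lambda>_. u" "\<lambda>_. v"] that by (simp add: disjoint_family_on_def lessThan_Suc)
  have "dist (f x') (f x) < e" if "x' \<in> {a..b}" "dist x' x < d" for x'
  proof (cases "x' \<le> x")
    case True
    then have "norm (f x - f x') < e" using d1 x that by (simp add: dist_real_def)
    then show ?thesis by (simp add: dist_norm norm_minus_commute)
  next
    case False
    then show ?thesis using d1[of x x'] x that by (simp add: dist_norm dist_real_def)
  qed
  then show "\<exists>d>0. \<forall>x'\<in>{a..b}. dist x' x < d \<longrightarrow> dist (f x') (f x) < e"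
    using \<open>d > 0\<close> by blast
qed

lemma small_increments_lipschitz:
  assumes lip: "\<And>u v. \<lbrakk>u \<in> S; v \<in> S; u \<le> v\<rbrakk> \<Longrightarrow> norm (f v - f u) \<le> M * (v - u)" and "e > 0"
  shows "\<exists>d>0. small_increments S f d e"
proof -
  define M' where "M' = max M 0 + 1"
  have M': "M' > 0" "M \<le> M'" by (auto simp: M'_def)
  have "small_increments S f (e / M') e"
  proof (rule small_incrementsI)
    fix n :: nat and a b :: "nat \<Rightarrow> real"
    assume ab: "\<And>k. k < n \<Longrightarrow> a k \<le> b k \<and> {a k..b k} \<subseteq> S" and s: "(\<Sum>k<n. b k - a k) < e / M'"
    have "(\<Sum>k<n. norm (f (b k) - f (a k))) \<le> (\<Sum>k<n. M' * (b k - a k))"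
    proof (rule sum_mono)
      fix k assume k: "k \<in> {..<n}"
      then have k: "a k \<le> b k" "{a k..b k} \<subseteq> S" using ab by auto
      then have "norm (f (b k) - f (a k)) \<le> M * (b k - a k)" by (intro lip) auto
      also have "\<dots> \<le> M' * (b k - a k)" using k M' by (intro mult_right_mono) auto
      finally show "norm (f (b k) - f (a k)) \<le> M' * (b k - a k)" .
    qed
    also have "\<dots> = M' * (\<Sum>k<n. b k - a k)" by (simp add: sum_distrib_left)
    also have "\<dots> < e" using s M' by (simp add: field_simps)
    finally show "(\<Sum>k<n. norm (f (b k) - f (a k))) < e" .
  qed
  then show ?thesis using M' \<open>e > 0\<close> by (intro exI[of _ "e / M'"]) auto
qed

text \<open>
  The form in which absolute continuity is inherited by products and inner products: each increment is
  bounded by a combination of the increments of the factors.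
\<close>
lemma absolutely_continuous_on_dominated:
  assumes g: "absolutely_continuous_on S g" and h: "absolutely_continuous_on S h"
    and f: "\<And>u v. \<lbrakk>u \<in> S; v \<in> S; u \<le> v\<rbrakk> \<Longrightarrow> norm (f v - f u) \<le> C * (norm (g v - g u) + norm (h v - h u))"
  shows "absolutely_continuous_on S f"
  unfolding absolutely_continuous_on_iff_small_increments
proof (intro allI impI)
  fix e :: real assume "e > 0"
  define C' where "C' = max C 0 + 1"
  have C': "C' > 0" "C \<le> C'" by (auto simp: C'_def)
  then have e': "e / (2 * C') > 0" using \<open>e > 0\<close> by simp
  obtain d1 where "d1 > 0" and d1: "small_increments S g d1 (e / (2 * C'))"
    using g e' unfolding absolutely_continuous_on_iff_small_increments by blast
  obtain d2 where "d2 > 0" and d2: "small_increments S h d2 (e / (2 * C'))"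
    using h e' unfolding absolutely_continuous_on_iff_small_increments by blast
  have "small_increments S f (min d1 d2) e"
  proof (rule small_incrementsI)
    fix n :: nat and a b :: "nat \<Rightarrow> real"
    assume ab: "\<And>k. k < n \<Longrightarrow> a k \<le> b k \<and> {a k..b k} \<subseteq> S"
      and disj: "disjoint_family_on (\<lambda>k. {a k<..<b k}) {..<n}"
      and s: "(\<Sum>k<n. b k - a k) < min d1 d2"
    have "(\<Sum>k<n. norm (f (b k) - f (a k)))
        \<le> (\<Sum>k<n. C' * (norm (g (b k) - g (a k)) + norm (h (b k) - h (a k))))"
    proof (rule sum_mono)
      fix k assume k: "k \<in> {..<n}"
      then have "a k \<le> b k" "{a k..b k} \<subseteq> S" using ab by auto
      then have "norm (f (b k) - f (a k)) \<le> C * (norm (g (b k) - g (a k)) + norm (h (b k) - h (a k)))"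
        by (intro f) auto
      also have "\<dots> \<le> C' * (norm (g (b k) - g (a k)) + norm (h (b k) - h (a k)))"
        using C' by (intro mult_right_mono) auto
      finally show "norm (f (b k) - f (a k)) \<le> C' * (norm (g (b k) - g (a k)) + norm (h (b k) - h (a k)))" .
    qed
    also have "\<dots> = C' * ((\<Sum>k<n. norm (g (b k) - g (a k))) + (\<Sum>k<n. norm (h (b k) - h (a k))))"
      by (simp add: sum_distrib_left sum.distrib distrib_left)
    also have "\<dots> < C' * (e / (2 * C') + e / (2 * C'))"
    proof (intro mult_strict_left_mono add_strict_mono)
      show "(\<Sum>k<n. norm (g (b k) - g (a k))) < e / (2 * C')"
        using s by (intro small_incrementsD[OF d1 ab disj]) auto
      show "(\<Sum>k<n. norm (h (b k) - h (a k))) < e / (2 * C')"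
        using s by (intro small_incrementsD[OF d2 ab disj]) auto
    qed (rule C')
    also have "\<dots> = e" using C' by (simp add: field_simps)
    finally show "(\<Sum>k<n. norm (f (b k) - f (a k))) < e" .
  qed
  then show "\<exists>d>0. small_increments S f d e"
    using \<open>d1 > 0\<close> \<open>d2 > 0\<close> by (intro exI[of _ "min d1 d2"]) auto
qed

text \<open>
  Nonoverlapping intervals inside a set of measure less than \<open>d\<close> have total length less than \<open>d\<close>.
  The index set is arbitrary, so that it can be a part of a tagged division.
\<close>
lemma sum_increments_of_short_intervals:
  assumes d: "small_increments S f d e"
    and "finite I"
    and uv: "\<And>i. i \<in> I \<Longrightarrow> u i \<le> v i \<and> {u i..v i} \<subseteq> S \<inter> U"
    and disj: "disjoint_family_on (\<lambda>i. {u i<..<v i}) I"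
    and U: "U \<in> lmeasurable" "measure lebesgue U < d"
  shows "(\<Sum>i\<in>I. norm (f (v i) - f (u i))) < e"
proof -
  obtain h where h: "bij_betw h {..<card I} I"
    using ex_bij_betw_nat_finite[OF \<open>finite I\<close>] by (auto simp: atLeast0LessThan)
  have hI: "h k \<in> I" if "k < card I" for k using h that by (auto simp: bij_betw_def)
  have "(\<Sum>k<card I. v (h k) - u (h k)) = (\<Sum>i\<in>I. v i - u i)"
    using sum.reindex_bij_betw[OF h, of "\<lambda>i. v i - u i"] .
  also have "\<dots> = (\<Sum>i\<in>I. measure lebesgue {u i<..<v i})"
    using uv by (intro sum.cong) auto
  also have "\<dots> = measure lebesgue (\<Union>i\<in>I. {u i<..<v i})"
    using \<open>finite I\<close> disj by (intro measure_finite_Union[symmetric]) (auto simp: emeasure_lborel_Ioo uv)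
  also have "\<dots> \<le> measure lebesgue U"
  proof (rule measure_mono_fmeasurable)
    show "(\<Union>i\<in>I. {u i<..<v i}) \<subseteq> U"
    proof
      fix x assume "x \<in> (\<Union>i\<in>I. {u i<..<v i})"
      then obtain i where "i \<in> I" "x \<in> {u i..v i}" by auto
      then show "x \<in> U" using uv by blast
    qed
  qed (use U \<open>finite I\<close> in auto)
  also have "\<dots> < d" by (rule U)
  finally have lt: "(\<Sum>k<card I. v (h k) - u (h k)) < d" .
  have "disjoint_family_on (\<lambda>k. {u (h k)<..<v (h k)}) {..<card I}"
    unfolding disjoint_family_on_def
  proof (intro ballI impI)
    fix k l assume kl: "k \<in> {..<card I}" "l \<in> {..<card I}" "k \<noteq> l"
    then have "h k \<noteq> h l" using h by (auto simp: bij_betw_def inj_on_def)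
    then show "{u (h k)<..<v (h k)} \<inter> {u (h l)<..<v (h l)} = {}"
      using disj kl hI unfolding disjoint_family_on_def by blast
  qed
  then have "(\<Sum>k<card I. norm (f (v (h k)) - f (u (h k)))) < e"
    using uv hI lt by (intro small_incrementsD[OF d]) auto
  then show ?thesis
    using sum.reindex_bij_betw[OF h, of "\<lambda>i. norm (f (v i) - f (u i))"] by simp
qed

text \<open>
  A fine tagged division is split by its tags. At tags outside \<open>N\<close> the gauge makes each increment at
  most \<open>e\<close> times the length of the interval. The intervals with tags in \<open>N\<close> lie in an open set of small
  measure around \<open>N\<close>, so absolute continuity bounds the sum of their increments.
\<close>
theorem absolutely_continuous_nonincreasing:
  fixes f :: "real \<Rightarrow> real"
  assumes "a \<le> b" and f: "absolutely_continuous_on {a..b} f" and N: "negligible N"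
    and deriv: "\<And>t. t \<in> {a..b} - N \<Longrightarrow>
        \<exists>D\<le>0. (f has_vector_derivative D) (at t within {a..b})"
  shows "f b \<le> f a"
proof (rule field_le_epsilon)
  fix e0 :: real assume "e0 > 0"
  define e where "e = e0 / (1 + (b - a))"
  have "e > 0" using \<open>e0 > 0\<close> \<open>a \<le> b\<close> by (simp add: e_def)
  obtain d where "d > 0" and d: "small_increments {a..b} f d e"
    using f \<open>e > 0\<close> unfolding absolutely_continuous_on_iff_small_increments by blast
  have null: "N \<in> null_sets lebesgue" using N by (simp add: negligible_iff_null_sets)
  then obtain U where U: "open U" "N \<subseteq> U" "U - N \<in> lmeasurable" "emeasure lebesgue (U - N) < ennreal d"
    using sets_lebesgue_outer_open[OF _ \<open>d > 0\<close>] by (metis null_setsD2)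
  have Um: "U \<in> lmeasurable"
    using U null by (metis borel_open measurable_Diff_null_set sets_completionI_sets sets_lborel)
  then have "measure lebesgue (U - N) = measure lebesgue U"
    using null by (simp add: fmeasurableD measure_Diff_null_set)
  then have Ud: "measure lebesgue U < d"
    using U by (metis emeasure_eq_measure2 ennreal_leI not_less)
  have "\<exists>r>0. \<forall>y\<in>{a..b}. \<bar>y - t\<bar> < r \<longrightarrow> (t \<le> y \<longrightarrow> f y - f t \<le> e * (y - t)) \<and>
          (y \<le> t \<longrightarrow> f t - f y \<le> e * (t - y))" if t: "t \<in> {a..b} - N" for t
  proof -
    obtain D where "D \<le> 0" "(f has_vector_derivative D) (at t within {a..b})"
      using deriv t by blast
    then obtain r where "r > 0" and r: "\<And>y. y \<in> {a..b} \<Longrightarrow> norm (y - t) < r \<Longrightarrow>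
        norm (f y - f t - (y - t) * D) \<le> e * norm (y - t)"
      unfolding has_vector_derivative_def has_derivative_within_alt using \<open>e > 0\<close> by auto
    have "f y - f t \<le> e * (y - t)" if "y \<in> {a..b}" "\<bar>y - t\<bar> < r" "t \<le> y" for y
    proof -
      have "(y - t) * D \<le> 0" using that \<open>D \<le> 0\<close> by (simp add: mult_nonneg_nonpos)
      then show ?thesis using r[of y] that by simp
    qed
    moreover have "f t - f y \<le> e * (t - y)" if "y \<in> {a..b}" "\<bar>y - t\<bar> < r" "y \<le> t" for y
    proof -
      have "(y - t) * D \<ge> 0" using that \<open>D \<le> 0\<close> by (simp add: mult_nonpos_nonpos)
      then show ?thesis using r[of y] that by (simp add: abs_if split: if_splits)
    qed
    ultimately show ?thesis using \<open>r > 0\<close> by blast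
  qed
  then have "\<exists>r. \<forall>t\<in>{a..b} - N. r t > 0 \<and>
      (\<forall>y\<in>{a..b}. \<bar>y - t\<bar> < r t \<longrightarrow> (t \<le> y \<longrightarrow> f y - f t \<le> e * (y - t)) \<and>
          (y \<le> t \<longrightarrow> f t - f y \<le> e * (t - y)))"
    by (intro bchoice ballI)
  then obtain r where r: "\<forall>t\<in>{a..b} - N. r t > 0 \<and>
      (\<forall>y\<in>{a..b}. \<bar>y - t\<bar> < r t \<longrightarrow> (t \<le> y \<longrightarrow> f y - f t \<le> e * (y - t)) \<and>
          (y \<le> t \<longrightarrow> f t - f y \<le> e * (t - y)))" ..
  define \<gamma> where "\<gamma> t = (if t \<in> N then U else if t \<in> {a..b} then ball t (r t) else UNIV)" for t
  have "gauge \<gamma>"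
    using U r by (auto simp: gauge_def \<gamma>_def)
  then obtain p where p: "p tagged_division_of {a..b}" "\<gamma> fine p"
    using fine_division_exists_real by blast
  have pD: "\<exists>u v. k = {u..v} \<and> u \<le> x \<and> x \<le> v \<and> a \<le> u \<and> v \<le> b \<and> {u..v} \<subseteq> \<gamma> x" if xk: "(x,k) \<in> p" for x k
  proof -
    obtain u v where "k = {u..v}" using tagged_division_ofD(4)[OF p(1) xk] by auto
    moreover have "x \<in> k" "k \<subseteq> {a..b}" using tagged_division_ofD(2,3)[OF p(1) xk] by auto
    moreover have "k \<subseteq> \<gamma> x" using p(2) xk by (auto simp: fine_def)
    ultimately show ?thesis by (intro exI[of _ u] exI[of _ v]) auto
  qed
  define p1 where "p1 = {xk \<in> p. fst xk \<in> N}"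
  have fin: "finite p" using p(1) by (rule tagged_division_of_finite)
  have bad: "(\<Sum>i\<in>p1. norm (f (Sup (snd i)) - f (Inf (snd i)))) < e"
  proof (rule sum_increments_of_short_intervals[OF d])
    show "finite p1" using fin by (simp add: p1_def)
    show "Inf (snd i) \<le> Sup (snd i) \<and> {Inf (snd i)..Sup (snd i)} \<subseteq> {a..b} \<inter> U" if "i \<in> p1" for i
    proof -
      obtain x k where ik: "i = (x,k)" by (cases i)
      then have i: "(x,k) \<in> p" "x \<in> N" using that by (auto simp: p1_def)
      then obtain u v where "k = {u..v}" "u \<le> x" "x \<le> v" "a \<le> u" "v \<le> b" "{u..v} \<subseteq> \<gamma> x"
        using pD by blast
      then show ?thesis using i ik by (auto simp: \<gamma>_def)
    qed
    show "disjoint_family_on (\<lambda>i. {Inf (snd i)<..<Sup (snd i)}) p1"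
      unfolding disjoint_family_on_def
    proof (intro ballI impI)
      fix i j assume ij: "i \<in> p1" "j \<in> p1" "i \<noteq> j"
      obtain x k where i1: "i = (x,k)" by (cases i)
      obtain y l where j1: "j = (y,l)" by (cases j)
      have i: "i = (x,k)" "(x,k) \<in> p" and j: "j = (y,l)" "(y,l) \<in> p"
        using ij i1 j1 by (auto simp: p1_def)
      then have "interior k \<inter> interior l = {}" using ij tagged_division_ofD(5)[OF p(1)] by blast
      moreover obtain u v where "k = {u..v}" "u \<le> x" "x \<le> v" using pD[OF i(2)] by blast
      moreover obtain u' v' where "l = {u'..v'}" "u' \<le> y" "y \<le> v'" using pD[OF j(2)] by blast
      ultimately show "{Inf (snd i)<..<Sup (snd i)} \<inter> {Inf (snd j)<..<Sup (snd j)} = {}"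
        using i j by simp
    qed
  qed (use Um Ud in auto)
  have good: "f (Sup k) - f (Inf k) \<le> e * measure lborel k" if "(x,k) \<in> p - p1" for x k
  proof -
    have xk: "(x,k) \<in> p" "x \<notin> N" using that by (auto simp: p1_def)
    then obtain u v where uv: "k = {u..v}" "u \<le> x" "x \<le> v" "a \<le> u" "v \<le> b" "{u..v} \<subseteq> \<gamma> x"
      using pD by blast
    have x: "x \<in> {a..b} - N" using uv xk by auto
    have "u \<in> \<gamma> x" "v \<in> \<gamma> x" using uv by auto
    then have "\<bar>v - x\<bar> < r x" "\<bar>u - x\<bar> < r x" using x by (auto simp: \<gamma>_def dist_real_def)
    then have "f v - f x \<le> e * (v - x)" "f x - f u \<le> e * (x - u)"
      using r[rule_format, OF x] uv by auto
    then show ?thesis using uv by (simp add: algebra_simps)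
  qed
  have "f b - f a = (\<Sum>(x,k)\<in>p. f (Sup k) - f (Inf k))"
    using additive_tagged_division_1[OF \<open>a \<le> b\<close> p(1), of f] by simp
  also have "\<dots> = (\<Sum>(x,k)\<in>p1. f (Sup k) - f (Inf k)) + (\<Sum>(x,k)\<in>p-p1. f (Sup k) - f (Inf k))"
    using fin by (subst sum.subset_diff[of p1]) (auto simp: p1_def)
  also have "(\<Sum>(x,k)\<in>p1. f (Sup k) - f (Inf k)) \<le> (\<Sum>i\<in>p1. norm (f (Sup (snd i)) - f (Inf (snd i))))"
    by (rule sum_mono) (auto simp: split_def)
  also have "(\<Sum>(x,k)\<in>p-p1. f (Sup k) - f (Inf k)) \<le> (\<Sum>(x,k)\<in>p-p1. e * measure lborel k)"
    using good by (intro sum_mono) auto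
  also have "\<dots> \<le> (\<Sum>(x,k)\<in>p. e * measure lborel k)"
    using fin \<open>e > 0\<close> by (intro sum_mono2) auto
  also have "\<dots> = e * (b - a)"
    using additive_content_tagged_division[of p a b] p(1) \<open>a \<le> b\<close>
    by (simp add: split_def sum_distrib_left[symmetric])
  finally have "f b - f a \<le> e + e * (b - a)" using bad by simp
  also have "\<dots> = e * (1 + (b - a))" by (simp add: algebra_simps)
  also have "\<dots> = e0" using \<open>a \<le> b\<close> by (simp add: e_def)
  finally show "f b \<le> f a + e0" by simp
qed

section \<open>Limits of vector-valued integrals\<close>

text \<open>
  The inequality holds for Riemann sums over the same tagged division, so it passes to their limits
  in any normed space.
\<close>
lemma has_integral_norm_le:
  fixes f :: "real \<Rightarrow> 'a::real_normed_vector" and \<phi> :: "real \<Rightarrow> real"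
  assumes f: "(f has_integral I) {a..b}" and \<phi>: "(\<phi> has_integral J) {a..b}"
    and le: "\<And>t. t \<in> {a..b} \<Longrightarrow> norm (f t) \<le> \<phi> t"
  shows "norm I \<le> J"
proof (rule tendsto_le[OF division_filter_not_empty[of a b]])
  show "((\<lambda>p. \<Sum>(x,k)\<in>p. measure lborel k *\<^sub>R \<phi> x) \<longlongrightarrow> J) (division_filter (cbox a b))"
    using \<phi> unfolding box_real(2)[symmetric] has_integral_cbox .
  show "((\<lambda>p. norm (\<Sum>(x,k)\<in>p. measure lborel k *\<^sub>R f x)) \<longlongrightarrow> norm I) (division_filter (cbox a b))"
    using f unfolding box_real(2)[symmetric] has_integral_cbox by (rule tendsto_norm)
  show "\<forall>\<^sub>F p in division_filter (cbox a b). norm (\<Sum>(x,k)\<in>p. measure lborel k *\<^sub>R f x)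
      \<le> (\<Sum>(x,k)\<in>p. measure lborel k *\<^sub>R \<phi> x)"
  proof (rule eventually_mono[OF eventually_division_filter_tagged_division])
    fix p assume p: "p tagged_division_of cbox a b"
    show "norm (\<Sum>(x,k)\<in>p. measure lborel k *\<^sub>R f x) \<le> (\<Sum>(x,k)\<in>p. measure lborel k *\<^sub>R \<phi> x)"
    proof (rule sum_norm_le, clarify)
      fix x k assume xk: "(x,k) \<in> p"
      have "x \<in> {a..b}" using tagged_division_ofD(2,3)[OF p xk] by auto
      then show "norm (measure lborel k *\<^sub>R f x) \<le> measure lborel k *\<^sub>R \<phi> x"
        using le by (simp add: mult_left_mono)
    qed
  qed
qed

text \<open>
  The integrals of the approximants form a Cauchy sequence, and the Riemann sums of \<open>f\<close> differ from
  those of an approximant by at most a Riemann sum of the dominating function.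
\<close>
lemma integrable_L1_limit:
  fixes f :: "real \<Rightarrow> 'a::{real_normed_vector, complete_space}"
  assumes approx: "\<And>e. e > 0 \<Longrightarrow> \<exists>g (\<phi> :: real \<Rightarrow> real) I J. (g has_integral I) {a..b} \<and>
      (\<phi> has_integral J) {a..b} \<and> J < e \<and> (\<forall>t\<in>{a..b}. norm (f t - g t) \<le> \<phi> t)"
  shows "f integrable_on {a..b}"
proof -
  have "\<forall>n. \<exists>g (\<phi> :: real \<Rightarrow> real) I J. (g has_integral I) {a..b} \<and>
      (\<phi> has_integral J) {a..b} \<and> J < inverse (real (Suc n)) \<and> (\<forall>t\<in>{a..b}. norm (f t - g t) \<le> \<phi> t)"
    by (intro allI approx) simp
  then obtain g I J and \<phi> :: "nat \<Rightarrow> real \<Rightarrow> real"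
    where "\<forall>n. (g n has_integral I n) {a..b} \<and> (\<phi> n has_integral J n) {a..b} \<and>
      J n < inverse (real (Suc n)) \<and> (\<forall>t\<in>{a..b}. norm (f t - g n t) \<le> \<phi> n t)"
    unfolding choice_iff by blast
  then have g: "(g n has_integral I n) {a..b}" and \<phi>: "(\<phi> n has_integral J n) {a..b}"
    and J: "J n < inverse (real (Suc n))" 
    and fg: "t \<in> {a..b} \<Longrightarrow> norm (f t - g n t) \<le> \<phi> n t" for n t
    by blast+
  have I_diff: "norm (I m - I n) \<le> J m + J n" for m n
  proof (rule has_integral_norm_le)
    show "((\<lambda>t. g m t - g n t) has_integral I m - I n) {a..b}"
      by (intro has_integral_diff g)
    show "((\<lambda>t. \<phi> m t + \<phi> n t) has_integral J m + J n) {a..b}"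
      by (intro has_integral_add \<phi>)
    show "norm (g m t - g n t) \<le> \<phi> m t + \<phi> n t" if "t \<in> {a..b}" for t
      using norm_triangle_ineq4[of "f t - g n t" "f t - g m t"] fg[OF that, of m] fg[OF that, of n]
      by (simp add: algebra_simps)
  qed
  have "Cauchy I"
  proof (rule CauchyI)
    fix e :: real assume "e > 0"
    then obtain N where N: "inverse (real (Suc N)) < e / 2" using reals_Archimedean[of "e/2"] by auto
    have "norm (I m - I n) < e" if "m \<ge> N" "n \<ge> N" for m n
    proof -
      have "inverse (real (Suc m)) \<le> inverse (real (Suc N))" "inverse (real (Suc n)) \<le> inverse (real (Suc N))"
        using that by (auto intro!: le_imp_inverse_le)
      then show ?thesis using I_diff[of m n] J[of m] J[of n] N by linarith
    qed
    then show "\<exists>M. \<forall>m\<ge>M. \<forall>n\<ge>M. norm (I m - I n) < e" by blast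
  qed
  then obtain L where L: "I \<longlonglongrightarrow> L" using Cauchy_convergent convergent_def by blast
  have "(f has_integral L) (cbox a b)"
    unfolding has_integral_cbox
  proof (rule tendstoI)
    fix e :: real assume "e > 0"
    then obtain N where N: "inverse (real (Suc N)) < e / 4" using reals_Archimedean[of "e/4"] by auto
    obtain M where M: "\<And>n. n \<ge> M \<Longrightarrow> dist (I n) L < e / 4"
      using metric_LIMSEQ_D[OF L, of "e/4"] \<open>e > 0\<close> by auto
    define n where "n = max M N"
    have "inverse (real (Suc n)) \<le> inverse (real (Suc N))"
      by (auto simp: n_def intro!: le_imp_inverse_le)
    then have Jn: "J n < e / 4" using J[of n] N by linarith
    have In: "dist (I n) L < e / 4" using M[of n] by (simp add: n_def)
    have "\<forall>\<^sub>F p in division_filter (cbox a b). dist (\<Sum>(x,k)\<in>p. measure lborel k *\<^sub>R g n x) (I n) < e / 4"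
      using g[of n] \<open>e > 0\<close> unfolding box_real(2)[symmetric] has_integral_cbox
      by (intro tendstoD) auto
    moreover have "\<forall>\<^sub>F p in division_filter (cbox a b). dist (\<Sum>(x,k)\<in>p. measure lborel k *\<^sub>R \<phi> n x) (J n) < e / 4"
      using \<phi>[of n] \<open>e > 0\<close> unfolding box_real(2)[symmetric] has_integral_cbox
      by (intro tendstoD) auto
    moreover have "\<forall>\<^sub>F p in division_filter (cbox a b). p tagged_division_of cbox a b"
      by (rule eventually_division_filter_tagged_division)
    ultimately show "\<forall>\<^sub>F p in division_filter (cbox a b). dist (\<Sum>(x,k)\<in>p. measure lborel k *\<^sub>R f x) L < e"
    proof eventually_elim
      case (elim p)
      have "norm (\<Sum>(x,k)\<in>p. measure lborel k *\<^sub>R (f x - g n x)) \<le> (\<Sum>(x,k)\<in>p. measure lborel k *\<^sub>R \<phi> n x)"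
      proof (rule sum_norm_le, clarify)
        fix x k assume xk: "(x,k) \<in> p"
        have "x \<in> {a..b}" using tagged_division_ofD(2,3)[OF elim(3) xk] by auto
        then show "norm (measure lborel k *\<^sub>R (f x - g n x)) \<le> measure lborel k *\<^sub>R \<phi> n x"
          using fg by (simp add: mult_left_mono)
      qed
      then have "dist (\<Sum>(x,k)\<in>p. measure lborel k *\<^sub>R f x) (\<Sum>(x,k)\<in>p. measure lborel k *\<^sub>R g n x)
          \<le> (\<Sum>(x,k)\<in>p. measure lborel k *\<^sub>R \<phi> n x)"
        by (simp add: dist_norm split_def sum_subtractf scaleR_diff_right)
      also have "\<dots> < e / 2" using elim(2) Jn unfolding dist_real_def by linarith
      finally have "dist (\<Sum>(x,k)\<in>p. measure lborel k *\<^sub>R f x) (\<Sum>(x,k)\<in>p. measure lborel k *\<^sub>R g n x) < e / 2" .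
      then show ?case
        using elim(1) In
          dist_triangle[of "\<Sum>(x,k)\<in>p. measure lborel k *\<^sub>R f x" L "\<Sum>(x,k)\<in>p. measure lborel k *\<^sub>R g n x"]
          dist_triangle[of "\<Sum>(x,k)\<in>p. measure lborel k *\<^sub>R g n x" L "I n"]
        by linarith
    qed
  qed
  then show ?thesis by auto
qed

text \<open>
  Finite sums of bounded measurable real functions times fixed vectors. Compared with simple functions
  they are closed under multiplication by bounded measurable real functions, and boundedness makes
  their primitives Lipschitz.
\<close>
inductive finite_rank :: "(real \<Rightarrow> 'a::real_normed_vector) \<Rightarrow> bool" where
  zero: "finite_rank (\<lambda>_. 0)"
| add: "\<lbrakk>\<alpha> \<in> borel_measurable lebesgue; \<And>t. \<bar>\<alpha> t\<bar> \<le> M; finite_rank g\<rbrakk>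
    \<Longrightarrow> finite_rank (\<lambda>t. \<alpha> t *\<^sub>R v + g t)"

lemma finite_rank_add:
  assumes "finite_rank f" and g: "finite_rank g"
  shows "finite_rank (\<lambda>t. f t + g t)"
  using assms(1)
proof induction
  case (add \<alpha> M f v)
  have "finite_rank (\<lambda>t. \<alpha> t *\<^sub>R v + (f t + g t))" by (rule finite_rank.add) (use add in auto)
  then show ?case by (simp add: add.assoc)
qed (use g in simp)

lemma finite_rank_sum:
  assumes "finite I" "\<And>i. i \<in> I \<Longrightarrow> finite_rank (f i)"
  shows "finite_rank (\<lambda>t. \<Sum>i\<in>I. f i t)"
  using assms by (induction I rule: finite_induct) (auto intro: finite_rank.zero finite_rank_add)

lemma finite_rank_scaleR:
  assumes "finite_rank f" and m: "m \<in> borel_measurable lebesgue" "\<And>t. \<bar>m t\<bar> \<le> K"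
  shows "finite_rank (\<lambda>t. m t *\<^sub>R f t)"
  using assms(1)
proof induction
  case zero
  then show ?case using finite_rank.zero by simp
next
  case (add \<alpha> M f v)
  have "\<bar>m t * \<alpha> t\<bar> \<le> K * M" for t
    unfolding abs_mult using m(2) add(2) by (intro mult_mono) (auto intro: order_trans[OF abs_ge_zero])
  then have "finite_rank (\<lambda>t. (m t * \<alpha> t) *\<^sub>R v + m t *\<^sub>R f t)"
    using add m by (intro finite_rank.add) auto
  then show ?case by (simp add: scaleR_add_right)
qed

lemma finite_rank_simple_function:
  assumes s: "simple_function lebesgue s"
  shows "finite_rank s"
proof -
  have fin: "finite (range s)" using simple_functionD(1)[OF s] by simp
  have "finite_rank (\<lambda>t. indicator (s -` {v}) t *\<^sub>R v + 0)" for v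
  proof (rule finite_rank.add)
    have "s -` {v} \<in> sets lebesgue" using simple_functionD(2)[OF s, of "{v}"] by simp
    then show "indicator (s -` {v}) \<in> borel_measurable lebesgue" by simp
    show "\<bar>indicator (s -` {v}) t\<bar> \<le> (1::real)" for t by (simp add: indicator_def)
  qed (rule finite_rank.zero)
  then have "finite_rank (\<lambda>t. \<Sum>v\<in>range s. indicator (s -` {v}) t *\<^sub>R v)"
    by (intro finite_rank_sum fin) simp
  moreover have "(\<Sum>v\<in>range s. indicator (s -` {v}) t *\<^sub>R v) = s t" for t
  proof -
    have "(\<Sum>v\<in>range s. indicator (s -` {v}) t *\<^sub>R v) = (\<Sum>v\<in>{s t}. indicator (s -` {v}) t *\<^sub>R v)"
      using fin by (intro sum.mono_neutral_right) (auto simp: indicator_def)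
    then show ?thesis by simp
  qed
  ultimately show ?thesis by simp
qed

lemma bounded_measurable_integrable_on:
  fixes \<alpha> :: "real \<Rightarrow> real"
  assumes "\<alpha> \<in> borel_measurable lebesgue" "\<And>t. \<bar>\<alpha> t\<bar> \<le> M"
  shows "\<alpha> integrable_on {a..b}"
proof (rule measurable_bounded_by_integrable_imp_integrable)
  show "\<alpha> \<in> borel_measurable (lebesgue_on {a..b})"
    using assms(1) by (rule measurable_restrict_space1)
  show "(\<lambda>_. M) integrable_on {a..b}" by (rule integrable_const_ivl)
qed (use assms in auto)

text \<open>
  The claims hold for each real coefficient and are preserved by the finite sum.
\<close>
lemma finite_rank_primitive:
  fixes g :: "real \<Rightarrow> 'a::real_normed_vector"
  assumes "finite_rank g"
  shows "\<exists>G M. (\<forall>s t. 0 \<le> s \<longrightarrow> s \<le> t \<longrightarrow>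
             (g has_integral (G t - G s)) {s..t} \<and> norm (G t - G s) \<le> M * (t - s)) \<and>
           (\<forall>b. negligible {t \<in> {0<..<b}. \<not> (G has_vector_derivative g t) (at t)})"
  using assms
proof induction
  case zero
  show ?case by (intro exI[of _ "\<lambda>_. 0"] exI[of _ 0]) auto
next
  case (add \<alpha> K g v)
  then obtain G M where G: "\<And>s t. \<lbrakk>0 \<le> s; s \<le> t\<rbrakk> \<Longrightarrow>
      (g has_integral (G t - G s)) {s..t} \<and> norm (G t - G s) \<le> M * (t - s)"
    and G': "\<And>b. negligible {t \<in> {0<..<b}. \<not> (G has_vector_derivative g t) (at t)}"
    by blast
  have int: "\<alpha> integrable_on {s..t}" for s t
    by (rule bounded_measurable_integrable_on) (use add in auto)
  define A where "A t = integral {0..t} \<alpha>" for t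
  have A: "(\<alpha> has_integral (A t - A s)) {s..t}" if "0 \<le> s" "s \<le> t" for s t
    using Henstock_Kurzweil_Integration.integral_combine[of 0 s t \<alpha>] that int[of 0 t] int[of s t]
    by (simp add: A_def has_integral_iff algebra_simps)
  have K: "\<bar>A t - A s\<bar> \<le> K * (t - s)" if "0 \<le> s" "s \<le> t" for s t
  proof -
    have "((\<lambda>_. K) has_integral (t - s) *\<^sub>R K) {s..t}"
      using has_integral_const_real[of K s t] that by simp
    from has_integral_norm_le[OF A[OF that] this] add(2) show ?thesis by (simp add: mult.commute)
  qed
  show ?case
  proof (intro exI[of _ "\<lambda>t. A t *\<^sub>R v + G t"] exI[of _ "K * norm v + M"] conjI allI impI)
    fix s t :: real assume st: "0 \<le> s" "s \<le> t"
    have "((\<lambda>t. \<alpha> t *\<^sub>R v + g t) has_integral ((A t - A s) *\<^sub>R v + (G t - G s))) {s..t}"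
      using st A G by (intro has_integral_add has_integral_scaleR_left) auto
    then show "((\<lambda>t. \<alpha> t *\<^sub>R v + g t) has_integral (A t *\<^sub>R v + G t - (A s *\<^sub>R v + G s))) {s..t}"
      by (simp add: algebra_simps)
    have "norm (A t *\<^sub>R v + G t - (A s *\<^sub>R v + G s)) = norm ((A t - A s) *\<^sub>R v + (G t - G s))"
      by (simp add: algebra_simps)
    also have "\<dots> \<le> \<bar>A t - A s\<bar> * norm v + norm (G t - G s)"
      using norm_triangle_ineq[of "(A t - A s) *\<^sub>R v" "G t - G s"] by simp
    also have "\<dots> \<le> (K * (t - s)) * norm v + M * (t - s)"
      using K st G by (intro add_mono mult_right_mono) auto
    finally show "norm (A t *\<^sub>R v + G t - (A s *\<^sub>R v + G s)) \<le> (K * norm v + M) * (t - s)"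
      by (simp add: algebra_simps)
  next
    fix b :: real
    have "negligible {t \<in> {0<..<b}. \<not> (A has_vector_derivative \<alpha> t) (at t)}"
      using lebesgue_differentiation_real[OF int[of 0 b]] unfolding A_def .
    then show "negligible {t \<in> {0<..<b}. \<not> ((\<lambda>t. A t *\<^sub>R v + G t) has_vector_derivative \<alpha> t *\<^sub>R v + g t) (at t)}"
      by (rule negligible_subset[OF negligible_Un[OF _ G'[of b]]])
        (auto intro!: has_vector_derivative_add bounded_linear.has_vector_derivative[OF bounded_linear_scaleR_left])
  qed
qed

section \<open>Bochner integrable functions on an interval\<close>

lemma borel_measurable_AE_limit_lebesgue:
  fixes u :: "nat \<Rightarrow> real \<Rightarrow> real"
  assumes u [measurable]: "\<And>i. u i \<in> borel_measurable lebesgue"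
    and lim: "AE t in lebesgue. (\<lambda>i. u i t) \<longlonglongrightarrow> l t"
  shows "l \<in> borel_measurable lebesgue"
proof (rule measurableI)
  fix A :: "real set" assume [measurable]: "A \<in> sets borel"
  show "l -` A \<inter> space lebesgue \<in> sets lebesgue"
  proof (rule complete_measure.in_sets_AE[OF completion.complete_measure_axioms])
    show "(\<lambda>t. lim (\<lambda>i. u i t)) -` A \<inter> space lebesgue \<in> sets lebesgue" by measurable
    show "AE t in lebesgue. (t \<in> (\<lambda>t. lim (\<lambda>i. u i t)) -` A \<inter> space lebesgue)
        = (t \<in> l -` A \<inter> space lebesgue)"
      using lim by eventually_elim (auto simp: limI)
  qed auto
qed simp

text \<open>
  In a nonseparable space the difference of two Borel functions need not be Borel, so the norm is
  obtained as an almost everywhere limit of norms of simple functions.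
\<close>
lemma borel_measurable_norm_diff_simple:
  assumes f: "strongly_measurable lebesgue f" and s: "simple_function lebesgue s"
  shows "(\<lambda>t::real. norm (f t - s t)) \<in> borel_measurable lebesgue"
proof -
  obtain s' where s': "\<And>i::nat. simple_function lebesgue (s' i)"
    and lim: "AE t in lebesgue. (\<lambda>i. s' i t) \<longlonglongrightarrow> f t"
    using f unfolding strongly_measurable_def by blast
  show ?thesis
  proof (rule borel_measurable_AE_limit_lebesgue)
    show "(\<lambda>t. norm (s' i t - s t)) \<in> borel_measurable lebesgue" for i
      by (intro borel_measurable_simple_function simple_function_compose2[OF s' s])
    show "AE t in lebesgue. (\<lambda>i. norm (s' i t - s t)) \<longlonglongrightarrow> norm (f t - s t)"
      using lim by eventually_elim (intro tendsto_intros)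
  qed
qed

text \<open>
  Bochner integrability on \<open>[0, b]\<close>, phrased by domination: integrability is asked of the
  real function \<open>\<phi>\<close>, which makes the notion stable under sums, uniform limits and composition with
  nonexpansive maps, also when the range is not separable.
\<close>
definition bochner_on :: "real \<Rightarrow> (real \<Rightarrow> 'a::real_normed_vector) \<Rightarrow> bool" where
  "bochner_on b f \<longleftrightarrow> (\<forall>e>0. \<exists>g (\<phi> :: real \<Rightarrow> real). finite_rank g \<and> \<phi> integrable_on {0..b} \<and>
      integral {0..b} \<phi> < e \<and> (\<forall>t\<in>{0..b}. norm (f t - g t) \<le> \<phi> t))"

lemma bochner_onE:
  assumes "bochner_on b f" and "e > 0"
  obtains g and \<phi> :: "real \<Rightarrow> real" where "finite_rank g" "\<phi> integrable_on {0..b}" "integral {0..b} \<phi> < e"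
    "\<And>t. t \<in> {0..b} \<Longrightarrow> norm (f t - g t) \<le> \<phi> t"
  using assms unfolding bochner_on_def by blast

lemma bochner_onI:
  assumes "\<And>e. e > 0 \<Longrightarrow> \<exists>g (\<phi> :: real \<Rightarrow> real). finite_rank g \<and> \<phi> integrable_on {0..b} \<and>
      integral {0..b} \<phi> < e \<and> (\<forall>t\<in>{0..b}. norm (f t - g t) \<le> \<phi> t)"
  shows "bochner_on b f"
  using assms unfolding bochner_on_def by blast

text \<open>
  The simple functions from Bochner's definition approximate; the norm of the error is itself the
  dominating function, once it is known to be measurable.
\<close>
lemma locally_integrable_imp_bochner_on:
  assumes f: "locally_integrable f" and "b \<ge> 0"
  shows "bochner_on b f"
proof (rule bochner_onI)
  fix e :: real assume "e > 0"
  define h where "h t = indicator {0..b} t *\<^sub>R f t" for t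
  have "bochner_integrable lebesgue h" using f \<open>b \<ge> 0\<close> unfolding locally_integrable_def h_def by blast
  then obtain s where h: "strongly_measurable lebesgue h"
    and s: "\<And>i::nat. Bochner_Integration.simple_bochner_integrable lebesgue (s i)"
    and lim: "(\<lambda>i. \<integral>\<^sup>+t. ennreal (norm (h t - s i t)) \<partial>lebesgue) \<longlonglongrightarrow> 0"
    unfolding bochner_integrable_def by blast
  have "\<forall>\<^sub>F i in sequentially. (\<integral>\<^sup>+t. ennreal (norm (h t - s i t)) \<partial>lebesgue) < ennreal e"
    using \<open>e > 0\<close> by (intro order_tendstoD(2)[OF lim]) simp
  then obtain i where i: "(\<integral>\<^sup>+t. ennreal (norm (h t - s i t)) \<partial>lebesgue) < ennreal e"
    by (auto simp: eventually_sequentially)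
  have si: "simple_function lebesgue (s i)"
    using s[of i] by (auto elim: Bochner_Integration.simple_bochner_integrable.cases)
  define \<phi> where "\<phi> t = norm (h t - s i t)" for t
  have m: "\<phi> \<in> borel_measurable lebesgue"
    unfolding \<phi>_def by (rule borel_measurable_norm_diff_simple[OF h si])
  have int: "integrable lebesgue \<phi>"
    using m i by (intro integrableI_nonneg) (auto simp: \<phi>_def intro: less_trans)
  have hi: "(\<phi> has_integral (integral\<^sup>L lebesgue \<phi>)) UNIV"
    by (rule has_integral_integral_lebesgue[OF int])
  have on: "\<phi> integrable_on {0..b}"
    using integrable_on_subcbox[of \<phi> UNIV 0 b] hi by auto
  have "integral {0..b} \<phi> \<le> integral UNIV \<phi>"
    using hi on by (intro integral_subset_le) (auto simp: \<phi>_def)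
  also have "\<dots> = integral\<^sup>L lebesgue \<phi>" using hi by (rule integral_unique)
  also have "ennreal (integral\<^sup>L lebesgue \<phi>) < ennreal e"
    using i nn_integral_eq_integral[OF int] by (simp add: \<phi>_def)
  then have "integral\<^sup>L lebesgue \<phi> < e" using \<open>e > 0\<close> by (simp add: ennreal_less_iff \<phi>_def)
  finally have "integral {0..b} \<phi> < e" .
  moreover have "norm (f t - s i t) \<le> \<phi> t" if "t \<in> {0..b}" for t
    using that by (simp add: \<phi>_def h_def)
  ultimately show "\<exists>g (\<phi> :: real \<Rightarrow> real). finite_rank g \<and> \<phi> integrable_on {0..b} \<and>
      integral {0..b} \<phi> < e \<and> (\<forall>t\<in>{0..b}. norm (f t - g t) \<le> \<phi> t)"
    using finite_rank_simple_function[OF si] on by blast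
qed

lemma bochner_on_const: "bochner_on b (\<lambda>_. v)"
proof (rule bochner_onI)
  have "finite_rank (\<lambda>t. 1 *\<^sub>R v + 0)" by (rule finite_rank.add[of _ 1]) (auto intro: finite_rank.zero)
  then show "\<exists>g (\<phi> :: real \<Rightarrow> real). finite_rank g \<and> \<phi> integrable_on {0..b} \<and>
      integral {0..b} \<phi> < e \<and> (\<forall>t\<in>{0..b}. norm (v - g t) \<le> \<phi> t)" if "e > 0" for e
    using that by (intro exI[of _ "\<lambda>_. v"] exI[of _ "\<lambda>_. 0"]) auto
qed

lemma bochner_on_add:
  assumes "bochner_on b f" "bochner_on b f'"
  shows "bochner_on b (\<lambda>t. f t + f' t)"
proof (rule bochner_onI)
  fix e :: real assume "e > 0"
  then have e2: "e / 2 > 0" by simp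
  obtain g \<phi> where g: "finite_rank g" "\<phi> integrable_on {0..b}" "integral {0..b} \<phi> < e / 2"
    "\<And>t. t \<in> {0..b} \<Longrightarrow> norm (f t - g t) \<le> \<phi> t"
    using bochner_onE[OF assms(1) e2] by blast
  obtain g' \<phi>' where g': "finite_rank g'" "\<phi>' integrable_on {0..b}" "integral {0..b} \<phi>' < e / 2"
    "\<And>t. t \<in> {0..b} \<Longrightarrow> norm (f' t - g' t) \<le> \<phi>' t"
    using bochner_onE[OF assms(2) e2] by blast
  show "\<exists>g (\<phi> :: real \<Rightarrow> real). finite_rank g \<and> \<phi> integrable_on {0..b} \<and>
      integral {0..b} \<phi> < e \<and> (\<forall>t\<in>{0..b}. norm (f t + f' t - g t) \<le> \<phi> t)"
  proof (intro exI[of _ "\<lambda>t. g t + g' t"] exI[of _ "\<lambda>t. \<phi> t + \<phi>' t"] conjI ballI)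
    show "finite_rank (\<lambda>t. g t + g' t)" using g g' by (intro finite_rank_add)
    show "(\<lambda>t. \<phi> t + \<phi>' t) integrable_on {0..b}" using g g' by (intro Henstock_Kurzweil_Integration.integrable_add)
    show "integral {0..b} (\<lambda>t. \<phi> t + \<phi>' t) < e"
      using g g' by (simp add: Henstock_Kurzweil_Integration.integral_add)
    show "norm (f t + f' t - (g t + g' t)) \<le> \<phi> t + \<phi>' t" if "t \<in> {0..b}" for t
      using g(4)[OF that] g'(4)[OF that] norm_diff_triangle_ineq[of "f t" "f' t" "g t" "g' t"] by linarith
  qed
qed

lemma bochner_on_sum:
  assumes "finite I" "\<And>i. i \<in> I \<Longrightarrow> bochner_on b (f i)"
  shows "bochner_on b (\<lambda>t. \<Sum>i\<in>I. f i t)"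
  using assms by (induction I rule: finite_induct) (auto intro: bochner_on_const bochner_on_add)

lemma bochner_on_scaleR:
  assumes f: "bochner_on b f"
    and m: "m \<in> borel_measurable lebesgue" and K: "\<And>t. t \<in> {0..b} \<Longrightarrow> \<bar>m t\<bar> \<le> K"
  shows "bochner_on b (\<lambda>t. m t *\<^sub>R f t)"
proof (rule bochner_onI)
  fix e :: real assume "e > 0"
  define K' where "K' = max K 0 + 1"
  have K': "K' > 0" "K \<le> K'" by (auto simp: K'_def)
  obtain g \<phi> where g: "finite_rank g" "\<phi> integrable_on {0..b}" "integral {0..b} \<phi> < e / K'"
    "\<And>t. t \<in> {0..b} \<Longrightarrow> norm (f t - g t) \<le> \<phi> t"
    using bochner_onE[OF f, of "e / K'"] K' \<open>e > 0\<close> by auto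
  show "\<exists>g (\<phi> :: real \<Rightarrow> real). finite_rank g \<and> \<phi> integrable_on {0..b} \<and>
      integral {0..b} \<phi> < e \<and> (\<forall>t\<in>{0..b}. norm (m t *\<^sub>R f t - g t) \<le> \<phi> t)"
  proof (intro exI[of _ "\<lambda>t. (indicator {0..b} t * m t) *\<^sub>R g t"] exI[of _ "\<lambda>t. K' * \<phi> t"] conjI ballI)
    show "finite_rank (\<lambda>t. (indicator {0..b} t * m t) *\<^sub>R g t)"
    proof (rule finite_rank_scaleR[OF g(1)])
      show "(\<lambda>t. indicator {0..b} t * m t) \<in> borel_measurable lebesgue"
        using m by (intro borel_measurable_times borel_measurable_indicator) auto
      show "\<bar>indicator {0..b} t * m t\<bar> \<le> K'" for t
        using K[of t] K' by (cases "t \<in> {0..b}") auto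
    qed
    show "(\<lambda>t. K' * \<phi> t) integrable_on {0..b}" using g by (intro integrable_on_mult_right)
    show "integral {0..b} (\<lambda>t. K' * \<phi> t) < e" using g K' by (simp add: field_simps)
    fix t assume t: "t \<in> {0..b}"
    have "norm (m t *\<^sub>R f t - (indicator {0..b} t * m t) *\<^sub>R g t) = \<bar>m t\<bar> * norm (f t - g t)"
      using t by (simp flip: scaleR_diff_right)
    also have "\<dots> \<le> K' * \<phi> t" using K[OF t] g(4)[OF t] K' by (intro mult_mono) auto
    finally show "norm (m t *\<^sub>R f t - (indicator {0..b} t * m t) *\<^sub>R g t) \<le> K' * \<phi> t" .
  qed
qed

lemma bochner_on_scaleR_continuous:
  assumes f: "bochner_on b f" and m: "continuous_on {0..b} m"
  shows "bochner_on b (\<lambda>t. m t *\<^sub>R f t)"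
proof -
  define m' where "m' t = indicator {0..b} t *\<^sub>R m t" for t :: real
  have "m' \<in> borel_measurable borel"
    unfolding m'_def using m by (intro borel_measurable_continuous_on_indicator) auto
  then have meas: "m' \<in> borel_measurable lebesgue"
    by (simp add: measurable_completion)
  obtain K where "\<And>t. t \<in> {0..b} \<Longrightarrow> norm (m t) \<le> K"
    using compact_imp_bounded[OF compact_continuous_image[OF m]] by (force simp: bounded_iff)
  then have "bochner_on b (\<lambda>t. m' t *\<^sub>R f t)"
    by (intro bochner_on_scaleR[OF f meas, of K]) (auto simp: m'_def)
  then show ?thesis unfolding bochner_on_def m'_def by simp
qed

lemma bochner_on_uniform_limit:
  assumes "\<And>e. e > 0 \<Longrightarrow> \<exists>g. bochner_on b g \<and> (\<forall>t\<in>{0..b}. norm (f t - g t) \<le> e)" and "b \<ge> 0"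
  shows "bochner_on b f"
proof (rule bochner_onI)
  fix e :: real assume "e > 0"
  define e' where "e' = e / (2 * (b + 1))"
  have "e' > 0" using \<open>e > 0\<close> \<open>b \<ge> 0\<close> by (simp add: e'_def)
  then obtain f' where f': "bochner_on b f'" "\<And>t. t \<in> {0..b} \<Longrightarrow> norm (f t - f' t) \<le> e'"
    using assms by blast
  have e2: "e / 2 > 0" using \<open>e > 0\<close> by simp
  obtain g \<phi> where g: "finite_rank g" "\<phi> integrable_on {0..b}" "integral {0..b} \<phi> < e / 2"
    "\<And>t. t \<in> {0..b} \<Longrightarrow> norm (f' t - g t) \<le> \<phi> t"
    using bochner_onE[OF f'(1) e2] by blast
  show "\<exists>g (\<phi> :: real \<Rightarrow> real). finite_rank g \<and> \<phi> integrable_on {0..b} \<and>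
      integral {0..b} \<phi> < e \<and> (\<forall>t\<in>{0..b}. norm (f t - g t) \<le> \<phi> t)"
  proof (intro exI[of _ g] exI[of _ "\<lambda>t. \<phi> t + e'"] conjI ballI)
    show "finite_rank g" by fact
    show "(\<lambda>t. \<phi> t + e') integrable_on {0..b}"
      using g by (intro Henstock_Kurzweil_Integration.integrable_add) auto
    have "integral {0..b} (\<lambda>t. \<phi> t + e') = integral {0..b} \<phi> + b * e'"
      using g \<open>b \<ge> 0\<close> by (subst Henstock_Kurzweil_Integration.integral_add) auto
    also have "b * e' \<le> e / 2"
      using \<open>e > 0\<close> \<open>b \<ge> 0\<close> by (simp add: e'_def field_simps)
    finally show "integral {0..b} (\<lambda>t. \<phi> t + e') < e" using g(3) by linarith
    show "norm (f t - g t) \<le> \<phi> t + e'" if "t \<in> {0..b}" for t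
      using norm_triangle_ineq[of "f t - f' t" "f' t - g t"] g(4)[OF that] f'(2)[OF that] by simp
  qed
qed

text \<open>
  Serves to change \<open>T\<close> at time \<open>0\<close>, where nothing is known about it.
\<close>
lemma bochner_on_cong_except_0:
  assumes f: "bochner_on b f" and eq: "\<And>t. t \<in> {0<..b} \<Longrightarrow> f' t = f t"
  shows "bochner_on b f'"
proof (rule bochner_onI)
  fix e :: real assume "e > 0"
  obtain g \<phi> where g: "finite_rank g" "\<phi> integrable_on {0..b}" "integral {0..b} \<phi> < e"
    "\<And>t. t \<in> {0..b} \<Longrightarrow> norm (f t - g t) \<le> \<phi> t"
    using bochner_onE[OF f \<open>e > 0\<close>] by blast
  \<comment> \<open>One value of an integrable dominating function can be chosen freely.\<close>
  define \<psi> where "\<psi> t = (if t = 0 then norm (f' 0 - g 0) else \<phi> t)" for t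
  have "(\<psi> has_integral integral {0..b} \<phi>) {0..b}"
    using g(2) by (intro has_integral_spike[of "{0}" "{0..b}" \<psi> \<phi>]) (auto simp: \<psi>_def)
  then have "\<psi> integrable_on {0..b}" "integral {0..b} \<psi> = integral {0..b} \<phi>"
    by (auto simp: integral_unique)
  moreover have "norm (f' t - g t) \<le> \<psi> t" if "t \<in> {0..b}" for t
    using g(4)[OF that] eq[of t] that by (cases "t = 0") (auto simp: \<psi>_def)
  ultimately show "\<exists>g (\<phi> :: real \<Rightarrow> real). finite_rank g \<and> \<phi> integrable_on {0..b} \<and>
      integral {0..b} \<phi> < e \<and> (\<forall>t\<in>{0..b}. norm (f' t - g t) \<le> \<phi> t)"
    using g by metis
qed

text \<open>
  By uniform continuity \<open>x\<close> is uniformly close to step functions with values in \<open>D\<close>. For a step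
  function in place of \<open>x\<close>, the composite is a finite sum of indicators times functions \<open>h c\<close>, and
  nonexpansiveness carries the uniform error over.
\<close>
lemma bochner_on_nonexpansive_composition:
  assumes h: "\<And>c. c \<in> D \<Longrightarrow> bochner_on b (h c)"
    and lip: "\<And>c c' t. \<lbrakk>c \<in> D; c' \<in> D; t \<in> {0..b}\<rbrakk> \<Longrightarrow> norm (h c t - h c' t) \<le> norm (c - c')"
    and x: "continuous_on {0..b} x" "\<And>t. t \<in> {0..b} \<Longrightarrow> x t \<in> D" and "b \<ge> 0"
  shows "bochner_on b (\<lambda>t. h (x t) t)"
proof (rule bochner_on_uniform_limit[OF _ \<open>b \<ge> 0\<close>])
  fix e :: real assume "e > 0"
  obtain d where "d > 0" and d: "\<And>s t. \<lbrakk>s \<in> {0..b}; t \<in> {0..b}; dist s t < d\<rbrakk> \<Longrightarrow> dist (x s) (x t) < e"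
    using compact_uniformly_continuous[OF x(1)] \<open>e > 0\<close> unfolding uniformly_continuous_on_def
    by (metis compact_Icc)
  define n where "n = nat \<lfloor>b / d\<rfloor>"
  define I where "I k = {real k * d..<real (Suc k) * d}" for k
  have kb: "real k * d \<in> {0..b}" if "k \<le> n" for k
  proof -
    have "real k \<le> real n" using that by simp
    also have "real n \<le> b / d" using \<open>d > 0\<close> \<open>b \<ge> 0\<close> by (simp add: n_def)
    finally show ?thesis using \<open>d > 0\<close> by (simp add: field_simps)
  qed
  define g where "g t = (\<Sum>k\<le>n. indicator (I k) t *\<^sub>R h (x (real k * d)) t)" for t
  have "bochner_on b g"
    unfolding g_def
  proof (intro bochner_on_sum bochner_on_scaleR[where K = 1] h)
    show "x (real k * d) \<in> D" if "k \<in> {..n}" for k using kb that x by simp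
    show "indicator (I k) \<in> borel_measurable lebesgue" for k
      by (intro borel_measurable_indicator) (simp add: I_def)
    show "\<bar>indicator (I k) t\<bar> \<le> (1::real)" for k t by (simp add: indicator_def)
  qed simp
  moreover have "norm (h (x t) t - g t) \<le> e" if t: "t \<in> {0..b}" for t
  proof -
    define k where "k = nat \<lfloor>t / d\<rfloor>"
    have rk: "real k = of_int \<lfloor>t / d\<rfloor>" using t \<open>d > 0\<close> by (simp add: k_def)
    have "real k \<le> t / d" "t / d < real (Suc k)"
      using of_int_floor_le[of "t / d"] real_of_int_floor_add_one_gt[of "t / d"] rk
      unfolding of_nat_Suc by linarith+
    then have k1: "real k * d \<le> t" "t < real (Suc k) * d"
      using \<open>d > 0\<close> by (simp_all add: pos_le_divide_eq pos_divide_less_eq)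
    have kn: "k \<le> n" unfolding k_def n_def using t \<open>d > 0\<close> by (intro nat_mono floor_mono divide_right_mono) auto
    have notin: "t \<notin> I j" if "j \<noteq> k" for j
    proof (cases "j < k")
      case True
      then have "real (Suc j) * d \<le> real k * d" using \<open>d > 0\<close> by (intro mult_right_mono) auto
      then show ?thesis using k1 by (auto simp: I_def)
    next
      case False
      then have "real (Suc k) * d \<le> real j * d" using \<open>d > 0\<close> that by (intro mult_right_mono) auto
      then show ?thesis using k1 by (auto simp: I_def)
    qed
    have "g t = (\<Sum>j\<in>{k}. indicator (I j) t *\<^sub>R h (x (real j * d)) t)"
      unfolding g_def using kn notin by (intro sum.mono_neutral_right) (auto simp: indicator_def)
    also have "\<dots> = h (x (real k * d)) t" using k1 by (simp add: I_def)
    finally have "norm (h (x t) t - g t) \<le> norm (x t - x (real k * d))"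
      using lip[of "x t" "x (real k * d)" t] x kb[OF kn] t by simp
    also have "\<dots> < e"
      using d[of t "real k * d"] t kb[OF kn] k1 by (simp add: dist_norm dist_real_def algebra_simps)
    finally show ?thesis by simp
  qed
  ultimately show "\<exists>g. bochner_on b g \<and> (\<forall>t\<in>{0..b}. norm (h (x t) t - g t) \<le> e)" by blast
qed

section \<open>Primitives of Bochner integrable functions\<close>

lemma nonneg_of_norm_le: "norm x \<le> (r::real) \<Longrightarrow> 0 \<le> r"
  using norm_ge_zero order_trans by blast

lemma bochner_on_integrable:
  fixes f :: "real \<Rightarrow> 'a::{real_normed_vector, complete_space}"
  assumes f: "bochner_on b f" and st: "0 \<le> s" "s \<le> t" "t \<le> b"
  shows "f integrable_on {s..t}"
proof (rule integrable_L1_limit)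
  fix e :: real assume "e > 0"
  obtain g \<phi> where g: "finite_rank g" "\<phi> integrable_on {0..b}" "integral {0..b} \<phi> < e"
    and \<phi>: "\<And>t. t \<in> {0..b} \<Longrightarrow> norm (f t - g t) \<le> \<phi> t"
    using bochner_onE[OF f \<open>e > 0\<close>] by blast
  obtain I where "(g has_integral I) {s..t}"
    using finite_rank_primitive[OF g(1)] st by blast
  moreover have int: "\<phi> integrable_on {s..t}"
    using integrable_subinterval_real[OF g(2)] st by simp
  moreover have "integral {s..t} \<phi> \<le> integral {0..b} \<phi>"
    using st by (intro integral_subset_le int g) (auto intro: nonneg_of_norm_le[OF \<phi>])
  ultimately show "\<exists>g (\<phi>::real \<Rightarrow> real) I J. (g has_integral I) {s..t} \<and>
      (\<phi> has_integral J) {s..t} \<and> J < e \<and> (\<forall>t\<in>{s..t}. norm (f t - g t) \<le> \<phi> t)"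
    using \<phi> g(3) st by (intro exI[of _ g] exI[of _ \<phi>] exI[of _ I] exI[of _ "integral {s..t} \<phi>"]) auto
qed

text \<open>
  Additivity of the integral over adjacent intervals, transferred from the approximants.
\<close>
lemma has_integral_difference_of_primitive:
  fixes f :: "real \<Rightarrow> 'a::{real_normed_vector, complete_space}"
  assumes f: "bochner_on b f" and st: "0 \<le> s" "s \<le> t" "t \<le> b"
  shows "(f has_integral (integral {0..t} f - integral {0..s} f)) {s..t}"
proof -
  define J where "J = integral {s..t} f - (integral {0..t} f - integral {0..s} f)"
  have int: "(f has_integral integral {u..v} f) {u..v}" if "0 \<le> u" "u \<le> v" "v \<le> b" for u v
    using bochner_on_integrable[OF f that] by auto
  have small: "norm J \<le> e" if "e > 0" for e
  proof -
    have e3: "e / 3 > 0" using that by simp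
    obtain g \<phi> where g: "finite_rank g" "\<phi> integrable_on {0..b}" "integral {0..b} \<phi> < e / 3"
      and \<phi>: "\<And>t. t \<in> {0..b} \<Longrightarrow> norm (f t - g t) \<le> \<phi> t"
      using bochner_onE[OF f e3] by blast
    obtain G where G: "\<And>s t. \<lbrakk>0 \<le> s; s \<le> t\<rbrakk> \<Longrightarrow> (g has_integral (G t - G s)) {s..t}"
      using finite_rank_primitive[OF g(1)] by blast
    have est: "norm (integral {u..v} f - (G v - G u)) \<le> e / 3" if uv: "0 \<le> u" "u \<le> v" "v \<le> b" for u v
    proof -
      have sub: "\<phi> integrable_on {u..v}"
        using integrable_subinterval_real[OF g(2)] uv by simp
      have "norm (integral {u..v} f - (G v - G u)) \<le> integral {u..v} \<phi>"
        using uv \<phi> sub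
        by (intro has_integral_norm_le[OF has_integral_diff[OF int G]]) auto
      also have "\<dots> \<le> integral {0..b} \<phi>"
        using uv by (intro integral_subset_le sub g) (auto intro: nonneg_of_norm_le[OF \<phi>])
      finally show ?thesis using g(3) by linarith
    qed
    have "J = (integral {s..t} f - (G t - G s)) - (integral {0..t} f - (G t - G 0)) + (integral {0..s} f - (G s - G 0))"
      by (simp add: J_def)
    also have "norm \<dots> \<le> norm (integral {s..t} f - (G t - G s)) + norm (integral {0..t} f - (G t - G 0))
        + norm (integral {0..s} f - (G s - G 0))"
      using norm_triangle_ineq[of "(integral {s..t} f - (G t - G s)) - (integral {0..t} f - (G t - G 0))"
          "integral {0..s} f - (G s - G 0)"]
        norm_triangle_ineq4[of "integral {s..t} f - (G t - G s)" "integral {0..t} f - (G t - G 0)"]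
      by linarith
    also have "\<dots> \<le> e" using est[of s t] est[of 0 t] est[of 0 s] st by simp
    finally show ?thesis .
  qed
  have "norm J \<le> 0" by (rule field_le_epsilon) (use small in auto)
  then have "integral {s..t} f = integral {0..t} f - integral {0..s} f" by (simp add: J_def)
  then show ?thesis using int[OF st] by simp
qed

text \<open>
  The common input for absolute continuity and for differentiability: up to an error controlled by the
  real function \<open>\<phi>\<close>, the primitive of \<open>f\<close> is a Lipschitz function \<open>G\<close> with almost everywhere derivative \<open>g\<close>.
\<close>
lemma bochner_on_primitive_approx:
  fixes f :: "real \<Rightarrow> 'a::{real_normed_vector, complete_space}"
  assumes f: "bochner_on b f" and "e > 0"
  obtains g G :: "real \<Rightarrow> 'a" and M :: real and \<phi> :: "real \<Rightarrow> real" where "\<phi> integrable_on {0..b}" "integral {0..b} \<phi> < e"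
    "\<And>t. t \<in> {0..b} \<Longrightarrow> norm (f t - g t) \<le> \<phi> t"
    "\<And>s t. \<lbrakk>0 \<le> s; s \<le> t; t \<le> b\<rbrakk> \<Longrightarrow> norm (G t - G s) \<le> M * (t - s)"
    "negligible {t \<in> {0<..<b}. \<not> (G has_vector_derivative g t) (at t)}"
    "\<And>s t. \<lbrakk>0 \<le> s; s \<le> t; t \<le> b\<rbrakk> \<Longrightarrow>
        norm (integral {0..t} f - integral {0..s} f - (G t - G s)) \<le> integral {s..t} \<phi>"
proof -
  obtain g \<phi> where g: "finite_rank g" "\<phi> integrable_on {0..b}" "integral {0..b} \<phi> < e"
    and \<phi>: "\<And>t. t \<in> {0..b} \<Longrightarrow> norm (f t - g t) \<le> \<phi> t"
    using bochner_onE[OF f \<open>e > 0\<close>] by blast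
  obtain G M where G: "\<And>s t. \<lbrakk>0 \<le> s; s \<le> t\<rbrakk> \<Longrightarrow>
        (g has_integral (G t - G s)) {s..t} \<and> norm (G t - G s) \<le> M * (t - s)"
      and G': "\<And>b. negligible {t \<in> {0<..<b}. \<not> (G has_vector_derivative g t) (at t)}"
    using finite_rank_primitive[OF g(1)] by blast
  have "norm (integral {0..t} f - integral {0..s} f - (G t - G s)) \<le> integral {s..t} \<phi>"
    if st: "0 \<le> s" "s \<le> t" "t \<le> b" for s t
  proof (rule has_integral_norm_le)
    show "((\<lambda>t. f t - g t) has_integral (integral {0..t} f - integral {0..s} f - (G t - G s))) {s..t}"
      using has_integral_diff[OF has_integral_difference_of_primitive[OF f st]] G st by blast
    show "(\<phi> has_integral integral {s..t} \<phi>) {s..t}"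
      using integrable_subinterval_real[OF g(2)] st by auto
  qed (use \<phi> st in auto)
  with G G' show thesis by (intro that[OF g(2,3) \<phi>, of G M]) auto
qed

text \<open>
  Pointwise, the restrictions of \<open>\<phi>\<close> to the open subintervals add up to at most \<open>\<phi>\<close>.
\<close>
lemma sum_integral_disjoint_subintervals_le:
  fixes \<phi> :: "real \<Rightarrow> real"
  assumes \<phi>: "\<phi> integrable_on {a..b}" "\<And>t. t \<in> {a..b} \<Longrightarrow> 0 \<le> \<phi> t" and "finite I"
    and uv: "\<And>i. i \<in> I \<Longrightarrow> u i \<le> v i \<and> {u i..v i} \<subseteq> {a..b}"
    and disj: "disjoint_family_on (\<lambda>i. {u i<..<v i}) I"
  shows "(\<Sum>i\<in>I. integral {u i..v i} \<phi>) \<le> integral {a..b} \<phi>"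
proof (rule has_integral_le)
  have "((\<lambda>t. if t \<in> {u i<..<v i} then \<phi> t else 0) has_integral integral {u i..v i} \<phi>) {a..b}"
    if i: "i \<in> I" for i
  proof -
    have "\<phi> integrable_on {u i..v i}" using integrable_subinterval_real[OF \<phi>(1)] uv[OF i] by blast
    then have "(\<phi> has_integral integral {u i..v i} \<phi>) {u i<..<v i}"
      using has_integral_open_interval[of \<phi> _ "u i" "v i"] by (auto simp: box_real)
    moreover have "{u i<..<v i} \<subseteq> {a..b}"
      using uv[OF i] greaterThanLessThan_subseteq_atLeastAtMost_iff[of "u i" "v i" "u i" "v i"] by blast
    ultimately show ?thesis by (subst has_integral_restrict)
  qed
  then show "((\<lambda>t. \<Sum>i\<in>I. if t \<in> {u i<..<v i} then \<phi> t else 0) has_integral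
      (\<Sum>i\<in>I. integral {u i..v i} \<phi>)) {a..b}"
    by (intro has_integral_sum \<open>finite I\<close>)
  show "(\<phi> has_integral integral {a..b} \<phi>) {a..b}" using \<phi>(1) by auto
  show "(\<Sum>i\<in>I. if t \<in> {u i<..<v i} then \<phi> t else 0) \<le> \<phi> t" if t: "t \<in> {a..b}" for t
  proof (cases "\<exists>i\<in>I. t \<in> {u i<..<v i}")
    case True
    then obtain i where i: "i \<in> I" "t \<in> {u i<..<v i}" by blast
    then have "t \<notin> {u j<..<v j}" if "j \<in> I - {i}" for j
      using disj that unfolding disjoint_family_on_def by blast
    then have "(\<Sum>i\<in>I. if t \<in> {u i<..<v i} then \<phi> t else 0) = (\<Sum>i\<in>{i}. if t \<in> {u i<..<v i} then \<phi> t else 0)"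
      using i \<open>finite I\<close> by (intro sum.mono_neutral_right) auto
    then show ?thesis using i by simp
  next
    case False
    then have "(\<Sum>i\<in>I. if t \<in> {u i<..<v i} then \<phi> t else 0) = 0" by (intro sum.neutral) auto
    then show ?thesis using \<phi>(2)[OF t] by simp
  qed
qed

text \<open>
  Increments of the primitive are bounded by those of the Lipschitz function \<open>G\<close>, plus integrals of
  \<open>\<phi>\<close>, which add up to at most the small integral of \<open>\<phi>\<close> over \<open>[0, b]\<close>.
\<close>
lemma absolutely_continuous_on_primitive:
  fixes f :: "real \<Rightarrow> 'a::{real_normed_vector, complete_space}"
  assumes f: "bochner_on b f"
  shows "absolutely_continuous_on {0..b} (\<lambda>t. integral {0..t} f)"
  unfolding absolutely_continuous_on_iff_small_increments
proof (intro allI impI)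
  fix e :: real assume "e > 0"
  define F where "F = (\<lambda>t. integral {0..t} f)"
  have e2: "e / 2 > 0" using \<open>e > 0\<close> by simp
  obtain g G :: "real \<Rightarrow> 'a" and M :: real and \<phi> :: "real \<Rightarrow> real"
    where \<phi>: "\<phi> integrable_on {0..b}" "integral {0..b} \<phi> < e / 2"
      "\<And>t. t \<in> {0..b} \<Longrightarrow> norm (f t - g t) \<le> \<phi> t"
    and lip: "\<And>s t. \<lbrakk>0 \<le> s; s \<le> t; t \<le> b\<rbrakk> \<Longrightarrow> norm (G t - G s) \<le> M * (t - s)"
    and "negligible {t \<in> {0<..<b}. \<not> (G has_vector_derivative g t) (at t)}"
    and G: "\<And>s t. \<lbrakk>0 \<le> s; s \<le> t; t \<le> b\<rbrakk> \<Longrightarrow>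
        norm (integral {0..t} f - integral {0..s} f - (G t - G s)) \<le> integral {s..t} \<phi>"
    by (rule bochner_on_primitive_approx[OF f e2]) (rule that; assumption)
  obtain d where "d > 0" and d: "small_increments {0..b} G d (e / 2)"
    using small_increments_lipschitz[of "{0..b}" G M "e / 2"] lip e2 by auto
  have "small_increments {0..b} F d e"
  proof (rule small_incrementsI)
    fix n :: nat and u v :: "nat \<Rightarrow> real"
    assume uv: "\<And>k. k < n \<Longrightarrow> u k \<le> v k \<and> {u k..v k} \<subseteq> {0..b}"
      and disj: "disjoint_family_on (\<lambda>k. {u k<..<v k}) {..<n}"
      and s: "(\<Sum>k<n. v k - u k) < d"
    have "(\<Sum>k<n. norm (F (v k) - F (u k))) \<le> (\<Sum>k<n. norm (G (v k) - G (u k)) + integral {u k..v k} \<phi>)"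
    proof (rule sum_mono)
      fix k assume "k \<in> {..<n}"
      then have "0 \<le> u k" "u k \<le> v k" "v k \<le> b" using uv[of k] by auto
      from G[OF this] norm_triangle_ineq[of "F (v k) - F (u k) - (G (v k) - G (u k))" "G (v k) - G (u k)"]
      show "norm (F (v k) - F (u k)) \<le> norm (G (v k) - G (u k)) + integral {u k..v k} \<phi>" by (simp add: F_def)
    qed
    also have "\<dots> = (\<Sum>k<n. norm (G (v k) - G (u k))) + (\<Sum>k<n. integral {u k..v k} \<phi>)"
      by (rule sum.distrib)
    also have "(\<Sum>k<n. norm (G (v k) - G (u k))) < e / 2"
      by (rule small_incrementsD[OF d uv disj s])
    also have "(\<Sum>k<n. integral {u k..v k} \<phi>) \<le> integral {0..b} \<phi>"
      using uv by (intro sum_integral_disjoint_subintervals_le \<phi> disj) (auto intro: nonneg_of_norm_le[OF \<phi>(3)])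
    finally show "(\<Sum>k<n. norm (F (v k) - F (u k))) < e" using \<phi>(2) by simp
  qed
  then show "\<exists>d>0. small_increments {0..b} (\<lambda>t. integral {0..t} f) d e"
    using \<open>d > 0\<close> unfolding F_def by blast
qed

text \<open>
  A sequence that tends to \<open>0\<close> in mean has a subsequence that tends to \<open>0\<close> almost everywhere.
\<close>
lemma negligible_not_small:
  fixes \<phi> :: "nat \<Rightarrow> real \<Rightarrow> real"
  assumes \<phi>: "\<And>n. \<phi> n integrable_on {a..b}" "\<And>n t. t \<in> {a..b} \<Longrightarrow> 0 \<le> \<phi> n t"
    and lim: "(\<lambda>n. integral {a..b} (\<phi> n)) \<longlonglongrightarrow> 0"
  shows "negligible {t \<in> {a..b}. \<exists>e>0. \<forall>n. e \<le> \<phi> n t}"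
proof -
  define u where "u n t = indicator {a..b} t *\<^sub>R \<phi> n t" for n t
  have abs: "\<phi> n absolutely_integrable_on {a..b}" for n
    using \<phi> by (intro nonnegative_absolutely_integrable_1) auto
  then have int: "integrable lebesgue (u n)" for n
    unfolding set_integrable_def u_def .
  have "(\<integral>t. norm (u n t) \<partial>lebesgue) = integral {a..b} (\<phi> n)" for n
  proof -
    have "(\<integral>t. norm (u n t) \<partial>lebesgue) = (LINT t:{a..b}|lebesgue. \<phi> n t)"
      unfolding set_lebesgue_integral_def u_def using \<phi>(2)
      by (intro Bochner_Integration.integral_cong) (auto simp: indicator_def)
    also have "\<dots> = integral {a..b} (\<phi> n)" by (rule set_lebesgue_integral_eq_integral(2)[OF abs])
    finally show ?thesis .
  qed
  then obtain r :: "nat \<Rightarrow> nat" where ae: "AE t in lebesgue. (\<lambda>n. u (r n) t) \<longlonglongrightarrow> 0"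
    using tendsto_L1_AE_subseq[of lebesgue u, OF int] lim by auto
  have "AE t in lebesgue. t \<notin> {t \<in> {a..b}. \<exists>e>0. \<forall>n. e \<le> \<phi> n t}"
    using ae
  proof eventually_elim
    case (elim t)
    show ?case
    proof
      assume "t \<in> {t \<in> {a..b}. \<exists>e>0. \<forall>n. e \<le> \<phi> n t}"
      then obtain e where "t \<in> {a..b}" "e > 0" "\<And>n. e \<le> \<phi> n t" by blast
      moreover obtain n where "u (r n) t < e"
        using order_tendstoD(2)[OF elim \<open>e > 0\<close>] by (auto simp: eventually_sequentially)
      ultimately show False by (auto simp: u_def not_le[symmetric])
    qed
  qed
  then show ?thesis
    unfolding eventually_ae_filter_negligible not_not Collect_mem_eq by (blast intro: negligible_subset)
qed

text \<open>
  At almost every \<open>t\<close>, every approximant \<open>G n\<close> has derivative \<open>g n t\<close>, every primitive of a dominating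
  function \<open>\<phi> n\<close> has derivative \<open>\<phi> n t\<close>, and \<open>\<phi> n t\<close> is arbitrarily small for suitable \<open>n\<close>. For
  such a \<open>t\<close>, the difference quotient of the primitive differs from \<open>f t\<close> by at most about \<open>2 * \<phi> n t\<close>.
\<close>
theorem has_vector_derivative_primitive_ae:
  fixes f :: "real \<Rightarrow> 'a::{real_normed_vector, complete_space}"
  assumes f: "bochner_on b f"
  shows "negligible {t \<in> {0<..<b}. \<not> ((\<lambda>t. integral {0..t} f) has_vector_derivative f t) (at t)}"
proof -
  define F where "F = (\<lambda>t. integral {0..t} f)"
  define approx where "approx n = (\<lambda>(g, G, \<phi>). \<phi> integrable_on {0..b} \<and> integral {0..b} \<phi> < inverse (real (Suc n)) \<and>
      (\<forall>t\<in>{0..b}. norm (f t - g t) \<le> \<phi> t) \<and>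
      negligible {t \<in> {0<..<b}. \<not> (G has_vector_derivative g t) (at t)} \<and>
      (\<forall>s t. 0 \<le> s \<and> s \<le> t \<and> t \<le> b \<longrightarrow> norm (F t - F s - (G t - G s)) \<le> integral {s..t} \<phi>))"
    for n :: nat
  have "\<exists>q. approx n q" for n
  proof -
    have pos: "inverse (real (Suc n)) > 0" by simp
    show ?thesis
    proof (rule bochner_on_primitive_approx[OF f pos])
      fix g G :: "real \<Rightarrow> 'a" and M :: real and \<phi> :: "real \<Rightarrow> real"
      assume "\<phi> integrable_on {0..b}" "integral {0..b} \<phi> < inverse (real (Suc n))"
        "\<And>t. t \<in> {0..b} \<Longrightarrow> norm (f t - g t) \<le> \<phi> t"
        "negligible {t \<in> {0<..<b}. \<not> (G has_vector_derivative g t) (at t)}"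
        "\<And>s t. \<lbrakk>0 \<le> s; s \<le> t; t \<le> b\<rbrakk> \<Longrightarrow>
          norm (integral {0..t} f - integral {0..s} f - (G t - G s)) \<le> integral {s..t} \<phi>"
      then have "approx n (g, G, \<phi>)" unfolding approx_def F_def by auto
      then show "\<exists>q. approx n q" ..
    qed
  qed
  then obtain q where q: "\<And>n. approx n (q n)" by metis
  define g where "g n = fst (q n)" for n
  define G where "G n = fst (snd (q n))" for n
  define \<phi> where "\<phi> n = snd (snd (q n))" for n
  have approx: "approx n (g n, G n, \<phi> n)" for n using q by (simp add: g_def G_def \<phi>_def)
  have int: "\<phi> n integrable_on {0..b}" and small: "integral {0..b} (\<phi> n) < inverse (real (Suc n))"
    and fg: "t \<in> {0..b} \<Longrightarrow> norm (f t - g n t) \<le> \<phi> n t"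
    and G: "negligible {t \<in> {0<..<b}. \<not> (G n has_vector_derivative g n t) (at t)}"
    and FG: "\<lbrakk>0 \<le> s; s \<le> t; t \<le> b\<rbrakk> \<Longrightarrow> norm (F t - F s - (G n t - G n s)) \<le> integral {s..t} (\<phi> n)"
    for n s t
    using approx[of n] by (auto simp: approx_def)
  define \<Phi> where "\<Phi> n t = integral {0..t} (\<phi> n)" for n t
  have \<Phi>: "negligible {t \<in> {0<..<b}. \<not> (\<Phi> n has_vector_derivative \<phi> n t) (at t)}" for n
    unfolding \<Phi>_def by (rule lebesgue_differentiation_real[OF int])
  have nonneg: "0 \<le> \<phi> n t" if "t \<in> {0..b}" for n t using nonneg_of_norm_le[OF fg[OF that]] .
  have lim: "(\<lambda>n. integral {0..b} (\<phi> n)) \<longlonglongrightarrow> 0"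
  proof (rule tendsto_sandwich[OF _ _ tendsto_const LIMSEQ_inverse_real_of_nat])
    show "\<forall>\<^sub>F n in sequentially. 0 \<le> integral {0..b} (\<phi> n)"
      using nonneg by (intro always_eventually allI integral_nonneg int) auto
    show "\<forall>\<^sub>F n in sequentially. integral {0..b} (\<phi> n) \<le> inverse (real (Suc n))"
      using small by (intro always_eventually allI less_imp_le)
  qed
  define N where "N = (\<Union>n. {t \<in> {0<..<b}. \<not> (G n has_vector_derivative g n t) (at t)}) \<union>
      (\<Union>n. {t \<in> {0<..<b}. \<not> (\<Phi> n has_vector_derivative \<phi> n t) (at t)}) \<union>
      {t \<in> {0..b}. \<exists>e>0. \<forall>n. e \<le> \<phi> n t}"
  have "negligible N"
    unfolding N_def using G \<Phi> negligible_not_small[OF int nonneg lim]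
    by (intro negligible_Un negligible_countable_Union) auto
  moreover have "(F has_vector_derivative f t) (at t)" if t: "t \<in> {0<..<b}" "t \<notin> N" for t
    unfolding has_vector_derivative_def has_derivative_at_alt
  proof (intro conjI allI impI bounded_linear_scaleR_left)
    fix e :: real assume "e > 0"
    then have e4: "e / 4 > 0" by simp
    have "\<not> (\<exists>e>0. \<forall>n. e \<le> \<phi> n t)" using t unfolding N_def by auto
    then obtain n where n: "\<phi> n t < e / 4" using e4 not_le by blast
    have "(G n has_vector_derivative g n t) (at t)" "(\<Phi> n has_vector_derivative \<phi> n t) (at t)"
      using t unfolding N_def by auto
    then obtain d1 d2 where "d1 > 0" "d2 > 0"
      and d1: "\<And>y. norm (y - t) < d1 \<Longrightarrow> norm (G n y - G n t - (y - t) *\<^sub>R g n t) \<le> e / 4 * norm (y - t)"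
      and d2: "\<And>y. norm (y - t) < d2 \<Longrightarrow> norm (\<Phi> n y - \<Phi> n t - (y - t) *\<^sub>R \<phi> n t) \<le> e / 4 * norm (y - t)"
      unfolding has_vector_derivative_def has_derivative_at_alt using e4 by blast
    have \<Phi>_diff: "integral {u..v} (\<phi> n) = \<Phi> n v - \<Phi> n u" if "0 \<le> u" "u \<le> v" "v \<le> b" for u v
      using Henstock_Kurzweil_Integration.integral_combine[of 0 u v "\<phi> n"]
        integrable_subinterval_real[OF int, of 0 v n] that by (auto simp: \<Phi>_def)
    show "\<exists>d>0. \<forall>y. norm (y - t) < d \<longrightarrow> norm (F y - F t - (y - t) *\<^sub>R f t) \<le> e * norm (y - t)"
    proof (intro exI[of _ "min (min d1 d2) (min t (b - t))"] conjI allI impI)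
      show "0 < min (min d1 d2) (min t (b - t))" using \<open>d1 > 0\<close> \<open>d2 > 0\<close> t by auto
      fix y assume y: "norm (y - t) < min (min d1 d2) (min t (b - t))"
      then have yb: "0 \<le> y" "y \<le> b" by (auto simp: abs_if split: if_splits)
      have "norm (F y - F t - (G n y - G n t)) \<le> \<bar>\<Phi> n y - \<Phi> n t\<bar>"
      proof (cases "t \<le> y")
        case True
        then show ?thesis using FG[of t y n] \<Phi>_diff[of t y] yb t by auto
      next
        case False
        then have "norm (F t - F y - (G n t - G n y)) \<le> \<bar>\<Phi> n t - \<Phi> n y\<bar>"
          using FG[of y t n] \<Phi>_diff[of y t] yb t by auto
        moreover have "F t - F y - (G n t - G n y) = - (F y - F t - (G n y - G n t))" by simp
        ultimately show ?thesis by (metis norm_minus_cancel abs_minus_commute)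
      qed
      moreover have "\<bar>\<Phi> n y - \<Phi> n t\<bar> \<le> e / 4 * \<bar>y - t\<bar> + \<bar>y - t\<bar> * \<phi> n t"
      proof -
        have "\<bar>(y - t) * \<phi> n t\<bar> = \<bar>y - t\<bar> * \<phi> n t" using nonneg[of t n] t by (simp add: abs_mult)
        moreover have "\<bar>\<Phi> n y - \<Phi> n t - (y - t) * \<phi> n t\<bar> \<le> e / 4 * \<bar>y - t\<bar>" using d2[of y] y by simp
        ultimately show ?thesis by linarith
      qed
      moreover have "norm (G n y - G n t - (y - t) *\<^sub>R g n t) \<le> e / 4 * \<bar>y - t\<bar>" using d1[of y] y by simp
      moreover have "norm ((y - t) *\<^sub>R (g n t - f t)) \<le> \<bar>y - t\<bar> * \<phi> n t"
        using fg[of t n] t by (simp add: norm_minus_commute mult_left_mono)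
      moreover have "\<bar>y - t\<bar> * \<phi> n t \<le> e / 4 * \<bar>y - t\<bar>"
        using n by (subst mult.commute) (intro mult_right_mono, auto)
      moreover have "norm (F y - F t - (y - t) *\<^sub>R f t) \<le> norm (F y - F t - (G n y - G n t)) +
          norm (G n y - G n t - (y - t) *\<^sub>R g n t) + norm ((y - t) *\<^sub>R (g n t - f t))"
      proof -
        have "F y - F t - (y - t) *\<^sub>R f t = (F y - F t - (G n y - G n t)) +
            (G n y - G n t - (y - t) *\<^sub>R g n t) + (y - t) *\<^sub>R (g n t - f t)"
          by (simp add: algebra_simps)
        then show ?thesis using norm_triangle_ineq norm_triangle_mono[OF _ order_refl] by metis
      qed
      ultimately show "norm (F y - F t - (y - t) *\<^sub>R f t) \<le> e * norm (y - t)" by simp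
    qed
  qed
  ultimately show ?thesis
    unfolding F_def[symmetric] by (elim negligible_subset) auto
qed

section \<open>Weighted means in closed convex sets\<close>

text \<open>
  Normalised Riemann sums are convex combinations of values of \<open>f\<close>, and the mean is their limit.
\<close>
lemma weighted_mean_in_convex:
  fixes f :: "real \<Rightarrow> 'a::real_normed_vector" and w :: "real \<Rightarrow> real"
  assumes D: "closed D" "convex D"
    and w: "(w has_integral m) {a..b}" and wf: "((\<lambda>t. w t *\<^sub>R f t) has_integral I) {a..b}" and "m > 0"
    and pos: "\<And>t. t \<in> {a..b} \<Longrightarrow> 0 \<le> w t" and fD: "\<And>t. t \<in> {a..b} \<Longrightarrow> f t \<in> D"
  shows "(1 / m) *\<^sub>R I \<in> D"
proof (rule Lim_in_closed_set[OF D(1) _ division_filter_not_empty[of a b]])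
  define S where "S p = (\<Sum>(x,k)\<in>p. measure lborel k *\<^sub>R w x)" for p :: "(real \<times> real set) set"
  have lim_S: "(S \<longlongrightarrow> m) (division_filter (cbox a b))"
    using w unfolding box_real(2)[symmetric] has_integral_cbox S_def .
  moreover have "((\<lambda>p. \<Sum>(x,k)\<in>p. measure lborel k *\<^sub>R w x *\<^sub>R f x) \<longlongrightarrow> I) (division_filter (cbox a b))"
    using wf unfolding box_real(2)[symmetric] has_integral_cbox .
  ultimately show "((\<lambda>p. (1 / S p) *\<^sub>R (\<Sum>(x,k)\<in>p. measure lborel k *\<^sub>R w x *\<^sub>R f x)) \<longlongrightarrow> (1 / m) *\<^sub>R I)
      (division_filter (cbox a b))"
    using \<open>m > 0\<close> by (intro tendsto_intros) auto
  have "\<forall>\<^sub>F p in division_filter (cbox a b). S p > 0"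
    using order_tendstoD(1)[OF lim_S \<open>m > 0\<close>] .
  then show "\<forall>\<^sub>F p in division_filter (cbox a b).
      (1 / S p) *\<^sub>R (\<Sum>(x,k)\<in>p. measure lborel k *\<^sub>R w x *\<^sub>R f x) \<in> D"
    using eventually_division_filter_tagged_division[of "cbox a b"]
  proof eventually_elim
    case (elim p)
    have tag: "fst i \<in> {a..b}" if "i \<in> p" for i
      using tagged_division_ofD(2,3)[OF elim(2), of "fst i" "snd i"] that by auto
    have "(\<Sum>i\<in>p. (measure lborel (snd i) * w (fst i) / S p) *\<^sub>R f (fst i)) \<in> D"
    proof (rule convex_sum[OF _ D(2)])
      show "finite p" using elim(2) by (rule tagged_division_of_finite)
      show "(\<Sum>i\<in>p. measure lborel (snd i) * w (fst i) / S p) = 1"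
        using elim(1) by (simp add: S_def split_def flip: sum_divide_distrib)
    qed (use elim(1) pos fD tag in auto)
    then show ?case by (simp add: split_def scaleR_sum_right mult.assoc)
  qed
qed

section \<open>The Picard operator of the regularized system\<close>

lemma bochner_on_continuous:
  assumes "continuous_on {0..b} f" and "b \<ge> 0"
  shows "bochner_on b f"
  by (rule bochner_on_nonexpansive_composition[where h = "\<lambda>c _. c" and D = UNIV])
    (use assms in \<open>auto intro: bochner_on_const\<close>)

lemma nonexpansive_onD:
  assumes "nonexpansive_on D T" and "x \<in> D"
  shows "T x \<in> D" and "x' \<in> D \<Longrightarrow> norm (T x - T x') \<le> norm (x - x')"
  using assms by (auto simp: nonexpansive_on_def)

text \<open>
  Closedness and convexity keep weighted means in \<open>D\<close>; continuity of \<open>\<epsilon>\<close> and \<open>y\<close> makes the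
  integrating factor continuously differentiable and the forcing term integrable.
\<close>
locale regularized_flow =
  fixes D :: "'a::{real_inner, complete_space} set"
    and T :: "real \<Rightarrow> 'a \<Rightarrow> 'a"
    and \<epsilon> :: "real \<Rightarrow> real"
    and y :: "real \<Rightarrow> 'a"
    and x0 :: 'a
  assumes closed_D: "closed D" and convex_D: "convex D" and x0: "x0 \<in> D"
    and T: "\<And>t. t > 0 \<Longrightarrow> nonexpansive_on D (T t)"
    and T_int: "\<And>x. x \<in> D \<Longrightarrow> locally_integrable (\<lambda>t. T t x)"
    and \<epsilon>_cont: "\<And>b. continuous_on {0..b} \<epsilon>" and \<epsilon>_nonneg: "\<And>t. t \<ge> 0 \<Longrightarrow> 0 \<le> \<epsilon> t"
    and y_cont: "\<And>b. continuous_on {0..b} y" and y_D: "\<And>t. t \<ge> 0 \<Longrightarrow> y t \<in> D"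
begin

text \<open>
  No hypothesis restricts \<open>T 0\<close>. The identity at time \<open>0\<close> makes the family nonexpansive on the
  closed half-line.
\<close>
definition T' :: "real \<Rightarrow> 'a \<Rightarrow> 'a" where
  "T' t = (if t = 0 then id else T t)"

text \<open>
  The exponent of the integrating factor for the linear part \<open>- (1 + \<epsilon>) x\<close> of the equation.
\<close>
definition A :: "real \<Rightarrow> real" where
  "A t = integral {0..t} (\<lambda>s. 1 + \<epsilon> s)"

definition force :: "(real \<Rightarrow> 'a) \<Rightarrow> real \<Rightarrow> 'a" where
  "force x t = T' t (x t) + \<epsilon> t *\<^sub>R y t"

text \<open>
  Variation of constants: the fixed points are the integrated form of the equation.
\<close>
definition picard :: "(real \<Rightarrow> 'a) \<Rightarrow> real \<Rightarrow> 'a" where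
  "picard x t = exp (- A t) *\<^sub>R (x0 + integral {0..t} (\<lambda>s. exp (A s) *\<^sub>R force x s))"

definition admissible :: "(real \<Rightarrow> 'a) \<Rightarrow> bool" where
  "admissible x \<longleftrightarrow> (\<forall>b. continuous_on {0..b} x) \<and> (\<forall>t\<ge>0. x t \<in> D)"

lemma T': "t \<ge> 0 \<Longrightarrow> nonexpansive_on D (T' t)"
  using T[of t] by (cases "t = 0") (auto simp: T'_def nonexpansive_on_def)

lemma A_has_vector_derivative:
  assumes "t \<in> {0..b}"
  shows "(A has_vector_derivative (1 + \<epsilon> t)) (at t within {0..b})"
  unfolding A_def using assms
  by (intro integral_has_vector_derivative continuous_intros \<epsilon>_cont)

lemma A_0: "A 0 = 0"
  by (simp add: A_def)

lemma A_mono: "\<lbrakk>0 \<le> s; s \<le> t\<rbrakk> \<Longrightarrow> A s \<le> A t"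
  unfolding A_def
  by (intro integral_subset_le integrable_continuous_real continuous_intros \<epsilon>_cont)
    (auto simp: \<epsilon>_nonneg add_nonneg_nonneg)

lemma A_nonneg: "0 \<le> t \<Longrightarrow> 0 \<le> A t"
  using A_mono[of 0 t] A_0 by simp

lemma A_cont: "continuous_on {0..b} A"
  unfolding continuous_on_eq_continuous_within
  by (intro ballI has_vector_derivative_continuous[OF A_has_vector_derivative])

lemma weight_has_integral:
  assumes "t \<ge> 0"
  shows "((\<lambda>s. exp (A s) * (1 + \<epsilon> s)) has_integral (exp (A t) - 1)) {0..t}"
proof -
  have "((\<lambda>s. exp (A s)) has_vector_derivative exp (A s) * (1 + \<epsilon> s)) (at s within {0..t})"
    if "s \<in> {0..t}" for s
    using A_has_vector_derivative[OF that]
    by (auto intro!: derivative_eq_intros simp flip: has_real_derivative_iff_has_vector_derivative)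
  from fundamental_theorem_of_calculus[OF assms this] show ?thesis by (simp add: A_0)
qed

lemma bochner_on_T': "\<lbrakk>c \<in> D; b \<ge> 0\<rbrakk> \<Longrightarrow> bochner_on b (\<lambda>t. T' t c)"
  by (rule bochner_on_cong_except_0[OF locally_integrable_imp_bochner_on[OF T_int]]) (auto simp: T'_def)

lemma bochner_on_weighted_force:
  assumes x: "admissible x" and "b \<ge> 0"
  shows "bochner_on b (\<lambda>s. exp (A s) *\<^sub>R force x s)"
  unfolding force_def
proof (rule bochner_on_scaleR_continuous[OF bochner_on_add])
  show "bochner_on b (\<lambda>t. T' t (x t))"
  proof (rule bochner_on_nonexpansive_composition[where h = "\<lambda>c t. T' t c" and D = D])
    show "norm (T' t c - T' t c') \<le> norm (c - c')" if "c \<in> D" "c' \<in> D" "t \<in> {0..b}" for c c' t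
      using that by (intro nonexpansive_onD(2)[OF T']) auto
  qed (use assms in \<open>auto simp: admissible_def bochner_on_T'\<close>)
  have "continuous_on {0..b} (\<lambda>t. \<epsilon> t *\<^sub>R y t)" by (intro continuous_intros \<epsilon>_cont y_cont)
  then show "bochner_on b (\<lambda>t. \<epsilon> t *\<^sub>R y t)" using \<open>b \<ge> 0\<close> by (rule bochner_on_continuous)
  show "continuous_on {0..b} (\<lambda>s. exp (A s))" by (intro continuous_intros A_cont)
qed

text \<open>
  The integrand is \<open>exp A * (1 + \<epsilon>)\<close> times a \<open>D\<close>-valued function \<open>f\<close>, and the total weight is
  \<open>exp (A t) - 1\<close>; so \<open>picard x t\<close> combines \<open>x0\<close> and a mean of \<open>f\<close> with weights \<open>exp (- A t)\<close> and
  \<open>1 - exp (- A t)\<close>.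
\<close>
lemma picard_in_D:
  assumes x: "admissible x" and "t \<ge> 0"
  shows "picard x t \<in> D"
proof (cases "t = 0")
  case True
  then show ?thesis using x0 by (simp add: picard_def A_0)
next
  case False
  then have "t > 0" using \<open>t \<ge> 0\<close> by simp
  \<comment> \<open>The convex combination of \<open>T' s (x s)\<close> and \<open>y s\<close> in the ratio \<open>1 : \<epsilon> s\<close>.\<close>
  define f where "f s = (1 / (1 + \<epsilon> s)) *\<^sub>R T' s (x s) + (\<epsilon> s / (1 + \<epsilon> s)) *\<^sub>R y s" for s
  have f_D: "f s \<in> D" if "s \<ge> 0" for s
    unfolding f_def
  proof (rule convexD[OF convex_D])
    show "T' s (x s) \<in> D" using nonexpansive_onD(1)[OF T'] x that by (simp add: admissible_def)
    show "y s \<in> D" using y_D that by simp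
    show "1 / (1 + \<epsilon> s) + \<epsilon> s / (1 + \<epsilon> s) = 1"
      using \<epsilon>_nonneg[OF that] by (simp flip: add_divide_distrib)
  qed (use \<epsilon>_nonneg[OF that] in auto)
  have force_f: "exp (A s) *\<^sub>R force x s = (exp (A s) * (1 + \<epsilon> s)) *\<^sub>R f s" if "s \<ge> 0" for s
    using \<epsilon>_nonneg[OF that] by (simp add: force_def f_def scaleR_add_right add_nonneg_eq_0_iff)
  define I where "I = integral {0..t} (\<lambda>s. exp (A s) *\<^sub>R force x s)"
  have "((\<lambda>s. exp (A s) *\<^sub>R force x s) has_integral I) {0..t}"
    unfolding I_def
    using bochner_on_integrable[OF bochner_on_weighted_force[OF x \<open>t \<ge> 0\<close>]] \<open>t \<ge> 0\<close> by auto
  then have I: "((\<lambda>s. (exp (A s) * (1 + \<epsilon> s)) *\<^sub>R f s) has_integral I) {0..t}"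
    by (rule has_integral_eq[rotated]) (simp add: force_f)
  \<comment> \<open>The weights have positive total mass, since \<open>1 + \<epsilon> \<ge> 1\<close>.\<close>
  have "t \<le> A t"
  proof (rule has_integral_le)
    show "((\<lambda>_. 1) has_integral t) {0..t}" using has_integral_const_real[of "1::real" 0 t] \<open>t > 0\<close> by simp
    show "((\<lambda>s. 1 + \<epsilon> s) has_integral A t) {0..t}"
      unfolding A_def by (intro integrable_integral integrable_continuous_real continuous_intros \<epsilon>_cont)
  qed (simp add: \<epsilon>_nonneg)
  then have "A t > 0" using \<open>t > 0\<close> by simp
  then have m: "exp (A t) - 1 > 0" by simp
  have "(1 / (exp (A t) - 1)) *\<^sub>R I \<in> D"
  proof (rule weighted_mean_in_convex[OF closed_D convex_D weight_has_integral[OF \<open>t \<ge> 0\<close>] I m])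
    show "0 \<le> exp (A s) * (1 + \<epsilon> s)" if "s \<in> {0..t}" for s
      using that \<epsilon>_nonneg[of s] by simp
  qed (use f_D in auto)
  then have "exp (- A t) *\<^sub>R x0 + (1 - exp (- A t)) *\<^sub>R ((1 / (exp (A t) - 1)) *\<^sub>R I) \<in> D"
    using \<open>A t > 0\<close> by (intro convexD[OF convex_D] x0) auto
  also have "(1 - exp (- A t)) *\<^sub>R ((1 / (exp (A t) - 1)) *\<^sub>R I) = exp (- A t) *\<^sub>R I"
  proof -
    have "(1 - exp (- A t)) = exp (- A t) * (exp (A t) - 1)"
      by (simp add: right_diff_distrib flip: exp_add)
    then show ?thesis using m by simp
  qed
  finally show ?thesis by (simp add: picard_def I_def scaleR_add_right)
qed

lemma exp_minus_A_diff:
  assumes "0 \<le> u" "u \<le> v"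
  shows "\<bar>exp (- A v) - exp (- A u)\<bar> \<le> \<bar>A v - A u\<bar>"
proof -
  have le: "A u \<le> A v" using A_mono[OF assms] .
  have "exp (- A u) - exp (- A v) = exp (- A u) * (1 - exp (- (A v - A u)))"
    by (simp add: right_diff_distrib flip: exp_add)
  also have "\<dots> \<le> 1 * (A v - A u)"
  proof (rule mult_mono)
    show "1 - exp (- (A v - A u)) \<le> A v - A u"
      using exp_ge_add_one_self[of "- (A v - A u)"] by linarith
  qed (use A_nonneg[of u] assms le in auto)
  finally show ?thesis using le by simp
qed

lemma absolutely_continuous_on_picard:
  assumes x: "admissible x" and "b \<ge> 0"
  shows "absolutely_continuous_on {0..b} (picard x)"
proof -
  define P where "P t = integral {0..t} (\<lambda>s. exp (A s) *\<^sub>R force x s)" for t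
  have P: "absolutely_continuous_on {0..b} P"
    unfolding P_def by (intro absolutely_continuous_on_primitive bochner_on_weighted_force assms)
  have A: "absolutely_continuous_on {0..b} A"
    unfolding A_def
    by (intro absolutely_continuous_on_primitive bochner_on_continuous continuous_intros \<epsilon>_cont \<open>b \<ge> 0\<close>)
  have "continuous_on {0..b} P" by (rule absolutely_continuous_on_continuous[OF P])
  then have "continuous_on {0..b} (\<lambda>t. x0 + P t)" by (intro continuous_intros)
  then obtain K where K: "\<And>t. t \<in> {0..b} \<Longrightarrow> norm (x0 + P t) \<le> K"
    using continuous_on_compact_bound[OF compact_Icc] by metis
  show ?thesis
  proof (rule absolutely_continuous_on_dominated[OF P A, where C = "max 1 K"])
    fix u v assume uv: "u \<in> {0..b}" "v \<in> {0..b}" "u \<le> v"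
    have "picard x v - picard x u = exp (- A v) *\<^sub>R (P v - P u) + (exp (- A v) - exp (- A u)) *\<^sub>R (x0 + P u)"
      unfolding picard_def P_def[symmetric] by (simp add: algebra_simps)
    also have "norm \<dots> \<le> exp (- A v) * norm (P v - P u) + \<bar>exp (- A v) - exp (- A u)\<bar> * norm (x0 + P u)"
      using norm_triangle_ineq[of "exp (- A v) *\<^sub>R (P v - P u)" "(exp (- A v) - exp (- A u)) *\<^sub>R (x0 + P u)"]
      by simp
    also have "\<dots> \<le> max 1 K * norm (P v - P u) + norm (A v - A u) * max 1 K"
    proof (intro add_mono mult_mono)
      have "exp (- A v) \<le> 1" using A_nonneg[of v] uv by simp
      then show "exp (- A v) \<le> max 1 K" by (rule max.coboundedI1)
      show "\<bar>exp (- A v) - exp (- A u)\<bar> \<le> norm (A v - A u)" using exp_minus_A_diff[of u v] uv by simp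
      show "norm (x0 + P u) \<le> max 1 K" using K[OF uv(1)] by (rule max.coboundedI2)
    qed auto
    finally show "norm (picard x v - picard x u) \<le> max 1 K * (norm (P v - P u) + norm (A v - A u))"
      by (simp add: algebra_simps)
  qed
qed

lemma admissible_picard: "admissible x \<Longrightarrow> admissible (picard x)"
  unfolding admissible_def[of "picard x"]
proof (intro conjI allI impI picard_in_D)
  fix b assume "admissible x"
  then show "continuous_on {0..b} (picard x)"
    using absolutely_continuous_on_continuous[OF absolutely_continuous_on_picard, of x b]
    by (cases "b \<ge> 0") auto
qed

text \<open>
  Bounding \<open>exp A\<close> by \<open>exp A * (1 + \<epsilon>)\<close>, whose integral is explicit, gives the factor
  \<open>exp (- A t) * (exp (A t) - 1) = 1 - exp (- A t)\<close>, which stays below \<open>1\<close> on \<open>[0, b]\<close>.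
\<close>
lemma picard_contraction:
  assumes x: "admissible x" and z: "admissible z" and t: "0 \<le> t" "t \<le> b"
    and K: "\<And>s. s \<in> {0..b} \<Longrightarrow> norm (x s - z s) \<le> K"
  shows "norm (picard x t - picard z t) \<le> (1 - exp (- A b)) * K"
proof -
  have "K \<ge> 0" using nonneg_of_norm_le[OF K[of 0]] t by simp
  let ?f = "\<lambda>x s. exp (A s) *\<^sub>R force x s"
  have int: "(?f x has_integral integral {0..t} (?f x)) {0..t}" if "admissible x" for x
    using bochner_on_integrable[OF bochner_on_weighted_force[OF that t(1)]] t by auto
  have "norm (integral {0..t} (?f x) - integral {0..t} (?f z)) \<le> (exp (A t) - 1) * K"
  proof (rule has_integral_norm_le)
    show "((\<lambda>s. ?f x s - ?f z s) has_integral integral {0..t} (?f x) - integral {0..t} (?f z)) {0..t}"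
      by (intro has_integral_diff int x z)
    show "((\<lambda>s. exp (A s) * (1 + \<epsilon> s) * K) has_integral (exp (A t) - 1) * K) {0..t}"
      by (intro has_integral_mult_left weight_has_integral t)
    fix s assume s: "s \<in> {0..t}"
    have "?f x s - ?f z s = exp (A s) *\<^sub>R (T' s (x s) - T' s (z s))"
      by (simp add: force_def algebra_simps)
    then have "norm (?f x s - ?f z s) = exp (A s) * norm (T' s (x s) - T' s (z s))"
      by simp
    also have "\<dots> \<le> exp (A s) * (1 + \<epsilon> s) * K"
    proof -
      have "norm (T' s (x s) - T' s (z s)) \<le> norm (x s - z s)"
        using nonexpansive_onD(2)[OF T'] x z s by (simp add: admissible_def)
      also have "\<dots> \<le> K" using K s t by simp
      also have "\<dots> \<le> (1 + \<epsilon> s) * K"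
        using \<open>K \<ge> 0\<close> \<epsilon>_nonneg[of s] s by (simp add: algebra_simps)
      finally show ?thesis by (simp add: mult.assoc)
    qed
    finally show "norm (?f x s - ?f z s) \<le> exp (A s) * (1 + \<epsilon> s) * K" .
  qed
  then have "exp (- A t) * norm (integral {0..t} (?f x) - integral {0..t} (?f z)) \<le> exp (- A t) * ((exp (A t) - 1) * K)"
    by (intro mult_left_mono) auto
  moreover have "picard x t - picard z t = exp (- A t) *\<^sub>R (integral {0..t} (?f x) - integral {0..t} (?f z))"
    by (simp add: picard_def algebra_simps)
  moreover have "exp (- A t) * ((exp (A t) - 1) * K) = (1 - exp (- A t)) * K"
    by (simp add: algebra_simps flip: exp_add mult.assoc)
  moreover have "(1 - exp (- A t)) * K \<le> (1 - exp (- A b)) * K"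
    using \<open>K \<ge> 0\<close> A_mono[OF t] by (intro mult_right_mono) auto
  ultimately show ?thesis by simp
qed

section \<open>Existence\<close>

definition iterate :: "nat \<Rightarrow> real \<Rightarrow> 'a" where
  "iterate n = (picard ^^ n) (\<lambda>_. x0)"

lemma iterate_0: "iterate 0 t = x0"
  by (simp add: iterate_def)

lemma iterate_Suc: "iterate (Suc n) = picard (iterate n)"
  by (simp add: iterate_def)

lemma admissible_iterate: "admissible (iterate n)"
proof (induction n)
  case 0
  show ?case using x0 by (simp add: admissible_def iterate_def)
next
  case (Suc n)
  then show ?case by (simp add: iterate_Suc admissible_picard)
qed

text \<open>
  With \<open>q\<close> the contraction constant and \<open>K\<close> a bound for the first step, \<open>C = K / (1 - q)\<close> is the
  fixed point of \<open>r \<mapsto> q * r + K\<close>; so it bounds the distance of all iterates from \<open>x0\<close>, and each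
  application of \<open>picard\<close> shrinks distances by \<open>q\<close>.
\<close>
lemma iterates_geometric:
  assumes "b \<ge> 0"
  shows "\<exists>C. \<forall>n k. \<forall>t\<in>{0..b}. norm (iterate (n + k) t - iterate n t) \<le> (1 - exp (- A b)) ^ n * C"
proof -
  define q where "q = 1 - exp (- A b)"
  have q: "0 \<le> q" "q < 1" using A_nonneg[OF assms] by (auto simp: q_def)
  have "continuous_on {0..b} (\<lambda>t. iterate 1 t - x0)"
    using admissible_iterate[of 1] by (intro continuous_intros) (auto simp: admissible_def)
  then obtain K where K: "\<And>t. t \<in> {0..b} \<Longrightarrow> norm (iterate 1 t - x0) \<le> K"
    using continuous_on_compact_bound[OF compact_Icc] by metis
  define C where "C = K / (1 - q)"
  have C: "q * C + K = C" using q by (simp add: C_def field_simps)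
  have "C \<ge> 0" using q nonneg_of_norm_le[OF K[of 0]] assms by (simp add: C_def)
  have bound: "norm (iterate k t - iterate 0 t) \<le> C" if "t \<in> {0..b}" for k t
    using that
  proof (induction k arbitrary: t)
    case 0
    then show ?case using \<open>C \<ge> 0\<close> by simp
  next
    case (Suc k)
    have "norm (iterate (Suc k) t - iterate 1 t) \<le> q * C"
      using picard_contraction[OF admissible_iterate[of k] admissible_iterate[of 0] _ _ Suc.IH, of t] Suc.prems
      by (simp add: iterate_Suc q_def)
    then have "norm (iterate (Suc k) t - iterate 1 t + (iterate 1 t - x0)) \<le> q * C + K"
      using K[OF Suc.prems] by (intro norm_triangle_mono)
    then show ?case by (simp add: C iterate_0)
  qed
  have "norm (iterate (n + k) t - iterate n t) \<le> q ^ n * C" if "t \<in> {0..b}" for n k t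
    using that
  proof (induction n arbitrary: t)
    case 0
    then show ?case using bound by simp
  next
    case (Suc n)
    then show ?case
      using picard_contraction[OF admissible_iterate[of "n + k"] admissible_iterate[of n] _ _ Suc.IH, of t]
      by (simp add: iterate_Suc q_def mult.assoc)
  qed
  then show ?thesis unfolding q_def by blast
qed

text \<open>
  The iterates are defined on the whole half-line, so one pointwise limit serves all intervals
  \<open>[0, b]\<close>, although the contraction constants tend to \<open>1\<close> as \<open>b\<close> grows.
\<close>
lemma picard_fixed_point: "\<exists>x. admissible x \<and> (\<forall>t\<ge>0. picard x t = x t)"
proof -
  obtain C where C: "\<And>b n k t. \<lbrakk>b \<ge> 0; t \<in> {0..b}\<rbrakk> \<Longrightarrow>
      norm (iterate (n + k) t - iterate n t) \<le> (1 - exp (- A b)) ^ n * C b"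
    using iterates_geometric by metis
  define r where "r b n = (1 - exp (- A b)) ^ n * C b" for b n
  have r: "r b \<longlonglongrightarrow> 0" if "b \<ge> 0" for b
    unfolding r_def using A_nonneg[OF that] by (intro tendsto_mult_left_zero LIMSEQ_realpow_zero) auto
  have dist_le: "norm (iterate m t - iterate n t) \<le> r b n" if "m \<ge> n" "t \<in> {0..b}" for m n t b
    using C[of b t n "m - n"] that by (simp add: r_def)
  have "Cauchy (\<lambda>n. iterate n t)" if "t \<ge> 0" for t
  proof (rule metric_CauchyI)
    fix e :: real assume "e > 0"
    then have "\<forall>\<^sub>F n in sequentially. r t n < e / 2"
      by (intro order_tendstoD(2)[OF r[OF that]]) simp
    then obtain N where N: "r t N < e / 2" by (auto simp: eventually_sequentially)
    have "dist (iterate m t) (iterate n t) < e" if "m \<ge> N" "n \<ge> N" for m n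
    proof -
      have "dist (iterate m t) (iterate N t) \<le> r t N" "dist (iterate n t) (iterate N t) \<le> r t N"
        using dist_le[of N _ t t] that \<open>t \<ge> 0\<close> by (auto simp: dist_norm)
      then show ?thesis using dist_triangle2[of "iterate m t" "iterate n t" "iterate N t"] N by linarith
    qed
    then show "\<exists>M. \<forall>m\<ge>M. \<forall>n\<ge>M. dist (iterate m t) (iterate n t) < e" by blast
  qed
  then have "\<forall>t. \<exists>l. t \<ge> 0 \<longrightarrow> (\<lambda>n. iterate n t) \<longlonglongrightarrow> l"
    using Cauchy_convergent convergent_def by blast
  then obtain x where x: "\<And>t. t \<ge> 0 \<Longrightarrow> (\<lambda>n. iterate n t) \<longlonglongrightarrow> x t" by metis
  have x_le: "norm (x t - iterate n t) \<le> r b n" if t: "t \<in> {0..b}" for t b n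
  proof (rule tendsto_upperbound)
    show "(\<lambda>m. norm (iterate m t - iterate n t)) \<longlonglongrightarrow> norm (x t - iterate n t)"
      using t by (intro tendsto_intros x) auto
    show "\<forall>\<^sub>F m in sequentially. norm (iterate m t - iterate n t) \<le> r b n"
      using dist_le[OF _ t] by (auto simp: eventually_sequentially)
  qed simp
  have "admissible x"
    unfolding admissible_def
  proof (intro conjI allI impI)
    fix b
    show "continuous_on {0..b} x"
    proof (cases "b \<ge> 0")
      case True
      have "uniform_limit {0..b} iterate x sequentially"
      proof (rule uniform_limitI)
        fix e :: real assume "e > 0"
        then have "\<forall>\<^sub>F n in sequentially. r b n < e" using order_tendstoD(2)[OF r[OF True]] by simp
        then show "\<forall>\<^sub>F n in sequentially. \<forall>t\<in>{0..b}. dist (iterate n t) (x t) < e"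
        proof eventually_elim
          case (elim n)
          then show ?case using x_le[of _ b n] by (force simp: dist_norm norm_minus_commute)
        qed
      qed
      moreover have "\<forall>\<^sub>F n in sequentially. continuous_on {0..b} (iterate n)"
        using admissible_iterate by (intro always_eventually allI) (auto simp: admissible_def)
      ultimately show ?thesis using uniform_limit_theorem sequentially_bot by blast
    qed simp
  next
    fix t :: real assume "t \<ge> 0"
    then have "iterate n t \<in> D" for n using admissible_iterate[of n] by (simp add: admissible_def)
    then show "x t \<in> D" by (rule closed_sequentially[OF closed_D _ x[OF \<open>t \<ge> 0\<close>]])
  qed
  moreover have "picard x t = x t" if "t \<ge> 0" for t
  proof -
    have "norm (picard x t - iterate (Suc n) t) \<le> (1 - exp (- A t)) * r t n" for n
      unfolding iterate_Suc using that x_le \<open>admissible x\<close>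
      by (intro picard_contraction admissible_iterate) auto
    then have "\<forall>\<^sub>F n in sequentially. norm (picard x t - iterate (Suc n) t) \<le> (1 - exp (- A t)) * r t n"
      by (rule always_eventually[OF allI])
    then have "(\<lambda>n. picard x t - iterate (Suc n) t) \<longlonglongrightarrow> 0"
      by (rule Lim_null_comparison) (rule tendsto_mult_right_zero[OF r[OF that]])
    moreover have "(\<lambda>n. picard x t - iterate (Suc n) t) \<longlonglongrightarrow> picard x t - x t"
      by (rule tendsto_diff[OF tendsto_const LIMSEQ_Suc[OF x[OF that]]])
    ultimately have "picard x t - x t = 0" by (rule LIMSEQ_unique[rotated])
    then show ?thesis by simp
  qed
  ultimately show ?thesis by blast
qed

lemma picard_has_vector_derivative_ae:
  assumes x: "admissible x" and "b \<ge> 0"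
  shows "negligible {t \<in> {0<..<b}. \<not> (picard x has_vector_derivative
            (force x t - (1 + \<epsilon> t) *\<^sub>R picard x t)) (at t)}"
proof -
  define P where "P t = integral {0..t} (\<lambda>s. exp (A s) *\<^sub>R force x s)" for t
  have "negligible {t \<in> {0<..<b}. \<not> (P has_vector_derivative exp (A t) *\<^sub>R force x t) (at t)}"
    unfolding P_def by (intro has_vector_derivative_primitive_ae bochner_on_weighted_force assms)
  moreover have "(picard x has_vector_derivative (force x t - (1 + \<epsilon> t) *\<^sub>R picard x t)) (at t)"
    if t: "t \<in> {0<..<b}" and P: "(P has_vector_derivative exp (A t) *\<^sub>R force x t) (at t)" for t
  proof -
    have "(A has_vector_derivative 1 + \<epsilon> t) (at t)"
      using A_has_vector_derivative[of t b] t by (simp add: at_within_Icc_at)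
    then have E: "((\<lambda>t. exp (- A t)) has_field_derivative - (1 + \<epsilon> t) * exp (- A t)) (at t)"
      by (auto intro!: derivative_eq_intros simp flip: has_real_derivative_iff_has_vector_derivative)
    have "((\<lambda>t. x0 + P t) has_vector_derivative 0 + exp (A t) *\<^sub>R force x t) (at t)"
      by (intro has_vector_derivative_add has_vector_derivative_const P)
    from has_vector_derivative_scaleR[OF E this]
    have "((\<lambda>t. exp (- A t) *\<^sub>R (x0 + P t)) has_vector_derivative
        exp (- A t) *\<^sub>R exp (A t) *\<^sub>R force x t + (- (1 + \<epsilon> t) * exp (- A t)) *\<^sub>R (x0 + P t)) (at t)"
      by simp
    moreover have "exp (- A t) *\<^sub>R exp (A t) *\<^sub>R force x t = force x t" by (simp flip: exp_add)
    moreover have "(- (1 + \<epsilon> t) * exp (- A t)) *\<^sub>R (x0 + P t) = - ((1 + \<epsilon> t) *\<^sub>R picard x t)"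
      unfolding picard_def P_def by (simp only: scaleR_scaleR scaleR_minus_left mult_minus_left)
    moreover have "(\<lambda>t. exp (- A t) *\<^sub>R (x0 + P t)) = picard x" by (simp add: picard_def P_def fun_eq_iff)
    ultimately show ?thesis by simp
  qed
  ultimately show ?thesis by (elim negligible_subset) auto
qed

text \<open>
  The exceptional sets on the intervals \<open>(0, n)\<close> are collected into one null set, to which time \<open>0\<close>
  is added.
\<close>
lemma fixed_point_is_solution:
  assumes x: "admissible x" and fp: "\<And>t. t \<ge> 0 \<Longrightarrow> picard x t = x t"
  shows "is_solution D T \<epsilon> y x0 x"
  unfolding is_solution_def
proof (intro conjI allI impI)
  show "AC_loc x"
    unfolding AC_loc_def
  proof (intro allI impI)
    fix b :: real assume "b \<ge> 0"
    from absolutely_continuous_on_picard[OF x this]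
    show "absolutely_continuous_on {0..b} x"
      by (rule absolutely_continuous_on_dominated[where C = 1, OF _ absolutely_continuous_on_picard[OF x \<open>b \<ge> 0\<close>]])
        (auto simp: fp)
  qed
  show "x t \<in> D" if "t \<ge> 0" for t using x that by (simp add: admissible_def)
  show "x 0 = x0" using fp[of 0] by (simp add: picard_def A_0)
  define N where "N = (\<Union>n::nat. {t \<in> {0<..<real n}. \<not> (picard x has_vector_derivative
            (force x t - (1 + \<epsilon> t) *\<^sub>R picard x t)) (at t)})"
  have "negligible (insert 0 N)"
    unfolding N_def negligible_insert
    using picard_has_vector_derivative_ae[OF x of_nat_0_le_iff]
    by (intro negligible_countable_Union) blast+
  moreover have "\<exists>x'. (x has_vector_derivative x') (at t within {0..}) \<and>
            - x' = x t - T t (x t) + \<epsilon> t *\<^sub>R (x t - y t)" if t: "t \<ge> 0" "t \<notin> insert 0 N" for t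
  proof -
    obtain n where "t < real n" using reals_Archimedean2 by blast
    then have "(picard x has_vector_derivative (force x t - (1 + \<epsilon> t) *\<^sub>R picard x t)) (at t)"
      using t unfolding N_def by auto
    then have "(picard x has_vector_derivative (force x t - (1 + \<epsilon> t) *\<^sub>R x t)) (at t within {0..})"
      using fp t by (simp add: has_vector_derivative_at_within)
    then have "(x has_vector_derivative (force x t - (1 + \<epsilon> t) *\<^sub>R x t)) (at t within {0..})"
      by (rule has_vector_derivative_transform[rotated 2]) (use t fp in auto)
    moreover have "- (force x t - (1 + \<epsilon> t) *\<^sub>R x t) = x t - T t (x t) + \<epsilon> t *\<^sub>R (x t - y t)"
      using t by (simp add: force_def T'_def algebra_simps)
    ultimately show ?thesis by blast
  qed
  ultimately show "AE t in lebesgue. t \<ge> 0 \<longrightarrow>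
      (\<exists>x'. (x has_vector_derivative x') (at t within {0..}) \<and>
            - x' = x t - T t (x t) + \<epsilon> t *\<^sub>R (x t - y t))"
    unfolding eventually_ae_filter_negligible by (intro exI[of _ "insert 0 N"]) blast
qed

section \<open>Uniqueness\<close>

text \<open>
  The derivative of the squared distance is at most \<open>- 2 \<epsilon>\<close> times the squared distance, since
  \<open>(w, T x - T z) \<le> \<parallel>w\<parallel>\<^sup>2\<close> for \<open>w = x - z\<close>.
\<close>
lemma solution_unique:
  assumes x: "is_solution D T \<epsilon> y x0 x" and z: "is_solution D T \<epsilon> y x0 z" and "b \<ge> 0"
  shows "z b = x b"
proof -
  define w where "w t = x t - z t" for t
  define u where "u t = w t \<bullet> w t" for t
  have ac: "absolutely_continuous_on {0..b} x" "absolutely_continuous_on {0..b} z"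
    using x z \<open>b \<ge> 0\<close> by (auto simp: is_solution_def AC_loc_def)
  then have "continuous_on {0..b} w"
    unfolding w_def by (intro continuous_intros absolutely_continuous_on_continuous)
  then obtain K where K: "\<And>t. t \<in> {0..b} \<Longrightarrow> norm (w t) \<le> K"
    using continuous_on_compact_bound[OF compact_Icc] by metis
  have "absolutely_continuous_on {0..b} u"
  proof (rule absolutely_continuous_on_dominated[OF ac, where C = "2 * K"])
    fix s t assume st: "s \<in> {0..b}" "t \<in> {0..b}"
    have "u t - u s = (w t - w s) \<bullet> (w t + w s)"
      by (simp add: u_def inner_diff_left inner_add_right inner_commute[of "w s" "w t"])
    then have "norm (u t - u s) \<le> norm (w t - w s) * norm (w t + w s)"
      using Cauchy_Schwarz_ineq2 by simp
    also have "norm (w t - w s) \<le> norm (x t - x s) + norm (z t - z s)"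
      using norm_triangle_ineq4[of "x t - x s" "z t - z s"] by (simp add: w_def algebra_simps)
    also have "norm (w t + w s) \<le> 2 * K"
      using norm_triangle_ineq[of "w t" "w s"] K[OF st(1)] K[OF st(2)] by simp
    finally show "norm (u t - u s) \<le> 2 * K * (norm (x t - x s) + norm (z t - z s))"
      by (simp add: mult.commute mult_right_mono)
  qed
  have "AE t in lebesgue. t \<ge> 0 \<longrightarrow> (\<exists>x' z'. (x has_vector_derivative x') (at t within {0..}) \<and>
      - x' = x t - T t (x t) + \<epsilon> t *\<^sub>R (x t - y t) \<and>
      (z has_vector_derivative z') (at t within {0..}) \<and> - z' = z t - T t (z t) + \<epsilon> t *\<^sub>R (z t - y t))"
    using x z unfolding is_solution_def by (elim conjE) (erule (1) eventually_elim2, blast)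
  then obtain N where "negligible N" and N: "\<And>t. \<lbrakk>t \<notin> N; t \<ge> 0\<rbrakk> \<Longrightarrow>
      \<exists>x' z'. (x has_vector_derivative x') (at t within {0..}) \<and>
      - x' = x t - T t (x t) + \<epsilon> t *\<^sub>R (x t - y t) \<and>
      (z has_vector_derivative z') (at t within {0..}) \<and> - z' = z t - T t (z t) + \<epsilon> t *\<^sub>R (z t - y t)"
    unfolding eventually_ae_filter_negligible by blast
  have "u b \<le> u 0"
  proof (rule absolutely_continuous_nonincreasing[OF \<open>b \<ge> 0\<close> \<open>absolutely_continuous_on {0..b} u\<close>])
    show "negligible (insert 0 N)" using \<open>negligible N\<close> by simp
    fix t assume t: "t \<in> {0..b} - insert 0 N"
    obtain x' z' where der: "(x has_vector_derivative x') (at t within {0..})"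
        "(z has_vector_derivative z') (at t within {0..})"
      and eq: "- x' = x t - T t (x t) + \<epsilon> t *\<^sub>R (x t - y t)" "- z' = z t - T t (z t) + \<epsilon> t *\<^sub>R (z t - y t)"
      using N[of t] t by auto
    have "(w has_vector_derivative x' - z') (at t within {0..b})"
      unfolding w_def
      by (intro has_vector_derivative_diff has_vector_derivative_within_subset[OF der(1)]
          has_vector_derivative_within_subset[OF der(2)]) auto
    from bounded_bilinear.has_vector_derivative[OF bounded_bilinear_inner this this]
    have "(u has_vector_derivative 2 * (w t \<bullet> (x' - z'))) (at t within {0..b})"
      unfolding u_def by (simp add: inner_commute)
    moreover have "w t \<bullet> (x' - z') \<le> 0"
    proof -
      have "x' - z' = - (- x') + (- z')" by simp
      also have "\<dots> = (T t (x t) - T t (z t)) - (1 + \<epsilon> t) *\<^sub>R w t"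
        unfolding eq by (simp add: w_def algebra_simps)
      finally have "w t \<bullet> (x' - z') = w t \<bullet> (T t (x t) - T t (z t)) - (1 + \<epsilon> t) * (norm (w t))\<^sup>2"
        by (simp add: inner_diff_right power2_norm_eq_inner)
      also have "w t \<bullet> (T t (x t) - T t (z t)) \<le> norm (w t) * norm (T t (x t) - T t (z t))"
        by (rule norm_cauchy_schwarz)
      also have "\<dots> \<le> norm (w t) * norm (w t)"
        unfolding w_def using x z t by (intro mult_left_mono nonexpansive_onD(2)[OF T]) (auto simp: is_solution_def)
      also have "norm (w t) * norm (w t) - (1 + \<epsilon> t) * (norm (w t))\<^sup>2 = - (\<epsilon> t * (norm (w t))\<^sup>2)"
        by (simp add: algebra_simps power2_eq_square)
      also have "\<dots> \<le> 0" using \<epsilon>_nonneg[of t] t by simp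
      finally show ?thesis by simp
    qed
    ultimately show "\<exists>d\<le>0. (u has_vector_derivative d) (at t within {0..b})"
      by (intro exI[of _ "2 * (w t \<bullet> (x' - z'))"]) auto
  qed
  also have "u 0 = 0" using x z by (simp add: u_def w_def is_solution_def)
  finally have "w b = 0" unfolding u_def using inner_gt_zero_iff[of "w b"] by linarith
  then show ?thesis by (simp add: w_def)
qed
end

theorem proposition4:
  fixes D :: "'a::{real_inner, complete_space} set"
    and T :: "real \<Rightarrow> 'a \<Rightarrow> 'a"
    and \<epsilon> :: "real \<Rightarrow> real"
    and y :: "real \<Rightarrow> 'a"
    and x0 :: 'a
  assumes "D \<noteq> {}" and "closed D" and "convex D"
    and "\<And>t. t > 0 \<Longrightarrow> nonexpansive_on D (T t)"
    and "\<And>t. t \<ge> 0 \<Longrightarrow> \<epsilon> t > 0"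
    and "absolutely_continuous_on {0..} \<epsilon>"
    and "antimono_on {0..} \<epsilon>"
    and "(\<epsilon> \<longlongrightarrow> 0) at_top"
    and "(\<integral>\<^sup>+s\<in>{0..}. ennreal (\<epsilon> s) \<partial>lebesgue) = \<infinity>"
    and "\<And>t. t \<ge> 0 \<Longrightarrow> y t \<in> D"
    and "AC_loc y"
    and "\<exists>l\<in>D. (y \<longlongrightarrow> l) at_top"
    and "((\<lambda>t. norm (vector_derivative y (at t within {0..}))) \<longlongrightarrow> 0) ess_at_top"
    and "locally_integrable \<epsilon>"
    and "locally_integrable y"
    and "\<And>x. x \<in> D \<Longrightarrow> locally_integrable (\<lambda>t. T t x)"
    and "x0 \<in> D"
  shows "\<exists>x. is_solution D T \<epsilon> y x0 x \<and>
             (\<forall>z. is_solution D T \<epsilon> y x0 z \<longrightarrow> (\<forall>t\<ge>0. z t = x t)) \<and>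
             (\<forall>t\<ge>0. x t \<in> D)"
proof -
  interpret regularized_flow D T \<epsilon> y x0
  proof
    show "continuous_on {0..b} \<epsilon>" for b
      by (rule absolutely_continuous_on_continuous[OF absolutely_continuous_on_subset[OF assms(6)]]) auto
    show "continuous_on {0..b} y" for b
    proof (cases "b \<ge> 0")
      case True
      then have "absolutely_continuous_on {0..b} y" using assms(11) by (simp add: AC_loc_def)
      then show ?thesis by (rule absolutely_continuous_on_continuous)
    qed simp
    show "0 \<le> \<epsilon> t" if "t \<ge> 0" for t using assms(5)[OF that] by simp
  qed (use assms in auto)
  obtain x where x: "admissible x" "\<And>t. t \<ge> 0 \<Longrightarrow> picard x t = x t"
    using picard_fixed_point by blast
  have sol: "is_solution D T \<epsilon> y x0 x" by (rule fixed_point_is_solution[OF x])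
  show ?thesis
  proof (intro exI[of _ x] conjI allI impI sol)
    show "z t = x t" if "is_solution D T \<epsilon> y x0 z" "t \<ge> 0" for z t
      using solution_unique[OF sol that] .
    show "x t \<in> D" if "t \<ge> 0" for t using x(1) that by (simp add: admissible_def)
  qed
qed

end
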